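(* Let $\mathbb{F}$ be an algebraically closed field (of arbitrary characteristic) and let $G$ be an abelian group. Let $\mathcal{U}$ and $\mathcal{V}$ be finite-dimensional $G$-graded simple $\mathbb{F}$-algebras (associative or non-associative). Then $\mathcal{U}$ and $\mathcal{V}$ satisfy the same $G$-graded polynomial identities if and only if they are isomorphic as $G$-graded algebras.
   Context: Algebras are not assumed associative or unital. An $\mathbb{F}$-algebra $\mathcal{U}$ is $G$-graded if it has a vector space decomposition $\mathcal{U}=\bigoplus_{g\in G}\mathcal{U}_g$ with $\mathcal{U}_g\mathcal{U}_h\subseteq\mathcal{U}_{gh}$ for all $g,h\in G$. A subspace $V\subseteq \mathcal{U}$ is homogeneous if $V=\bigoplus_{g\in G}(V\cap\mathcal{U}_g)$. $\mathcal{U}$ is graded simple if $\mathcal{U}^2\neq 0$ and the only homogeneous two-sided ideals of $\mathcal{U}$ are $0$ and $\mathcal{U}$. Two $G$-graded algebras $\mathcal{U},\mathcal{V}$ are isomorphic as graded algebras if there is an algebra isomorphism $\psi:\mathcal{U}\to\mathcal{V}$ with $\psi(\mathcal{U}_g)=\mathcal{V}_g$ for all $g\in G$. Let $X=\bigcup_{g\in G}X_g$ be a disjoint union of countably infinite sets and let $\mathbb{F}\{X\}$ be the absolutely free (non-associative) $\mathbb{F}$-algebra freely generated by $X$. A polynomial $f(x_1,\dots,x_n)\in\mathbb{F}\{X\}$ in variables $x_1\in X_{g_1},\dots,x_n\in X_{g_n}$ is a graded polynomial identity for $\mathcal{U}$ if $f(u_1,\dots,u_n)=0$ for all $u_1\in\mathcal{U}_{g_1},\dots,u_n\in\mathcal{U}_{g_n}$.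 *)

theory Defs
  imports "HOL-Library.Poly_Mapping" "HOL-Computational_Algebra.Polynomial"
begin

definition (in vector_space) is_direct_sum :: "'b set \<Rightarrow> ('i \<Rightarrow> 'b set) \<Rightarrow> bool" where
  "is_direct_sum V W \<longleftrightarrow>
     subspace V \<and> (\<forall>i. subspace (W i) \<and> W i \<subseteq> V) \<and>
     (\<forall>v\<in>V. \<exists>!c. (\<forall>i. c i \<in> W i) \<and> finite {i. c i \<noteq> 0} \<and> v = (\<Sum>i | c i \<noteq> 0. c i))"

text \<open>The abelian grading group is written additively. The product \<open>mult\<close> is only required to be
  bilinear: neither associativity nor a unit is assumed.\<close>

locale graded_algebra = vector_space scale
  for scale :: "'f::field \<Rightarrow> 'u::ab_group_add \<Rightarrow> 'u" +
  fixes mult :: "'u \<Rightarrow> 'u \<Rightarrow> 'u"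
    and comp :: "'g::ab_group_add \<Rightarrow> 'u set"
  assumes linear_mult_right: "Vector_Spaces.linear scale scale (\<lambda>y. mult x y)"
    and linear_mult_left: "Vector_Spaces.linear scale scale (\<lambda>x. mult x y)"
    and grading: "is_direct_sum UNIV comp"
    and mult_comp: "x \<in> comp g \<Longrightarrow> y \<in> comp h \<Longrightarrow> mult x y \<in> comp (g + h)"
begin

definition homogeneous :: "'u set \<Rightarrow> bool" where
  "homogeneous V \<longleftrightarrow> is_direct_sum V (\<lambda>g. V \<inter> comp g)"

definition two_sided_ideal :: "'u set \<Rightarrow> bool" where
  "two_sided_ideal I \<longleftrightarrow> subspace I \<and> (\<forall>a\<in>I. \<forall>x. mult x a \<in> I \<and> mult a x \<in> I)"

definition graded_simple :: bool where
  "graded_simple \<longleftrightarrow>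
     span {mult x y | x y. True} \<noteq> {0} \<and>
     (\<forall>I. two_sided_ideal I \<and> homogeneous I \<longrightarrow> I = {0} \<or> I = UNIV)"

end

locale fin_dim_graded_simple_algebra = graded_algebra scale mult comp
  for scale :: "'f::field \<Rightarrow> 'u::ab_group_add \<Rightarrow> 'u"
    and mult :: "'u \<Rightarrow> 'u \<Rightarrow> 'u"
    and comp :: "'g::ab_group_add \<Rightarrow> 'u set" +
  assumes finite_dim: "\<exists>B. finite_dimensional_vector_space scale B"
    and simple: graded_simple

text \<open>The free magma on \<open>'x\<close>, that is, the non-associative, non-empty monomials. The absolutely
  free algebra \<open>F{X}\<close> has the free magma on \<open>X\<close> as a basis, so its elements are the finitely
  supported functions from the free magma to \<open>F\<close>. The variables of degree \<open>g\<close> are the pairs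
  \<open>(g, i)\<close> with \<open>i\<close> a natural number, so each \<open>X\<^sub>g\<close> is countably infinite.\<close>

datatype (vars_magma: 'x) magma = Var 'x | Prod "'x magma" "'x magma"

type_synonym ('g, 'f) graded_poly = "('g \<times> nat) magma \<Rightarrow>\<^sub>0 'f"

definition vars :: "('g, 'f::zero) graded_poly \<Rightarrow> ('g \<times> nat) set" where
  "vars f = (\<Union>t\<in>Poly_Mapping.keys f. vars_magma t)"

primrec eval_magma :: "('u \<Rightarrow> 'u \<Rightarrow> 'u) \<Rightarrow> ('x \<Rightarrow> 'u) \<Rightarrow> 'x magma \<Rightarrow> 'u" where
  "eval_magma m u (Var x) = u x"
| "eval_magma m u (Prod s t) = m (eval_magma m u s) (eval_magma m u t)"

context graded_algebra
begin

definition eval_poly :: "('g \<times> nat \<Rightarrow> 'u) \<Rightarrow> ('g, 'f) graded_poly \<Rightarrow> 'u" where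
  "eval_poly u f =
     (\<Sum>t\<in>Poly_Mapping.keys f. scale (Poly_Mapping.lookup f t) (eval_magma mult u t))"

definition graded_identity :: "('g, 'f) graded_poly \<Rightarrow> bool" where
  "graded_identity f \<longleftrightarrow>
     (\<forall>u. (\<forall>(g, i)\<in>vars f. u (g, i) \<in> comp g) \<longrightarrow> eval_poly u f = 0)"

end

definition graded_isomorphic ::
  "('f::field \<Rightarrow> 'u::ab_group_add \<Rightarrow> 'u) \<Rightarrow> ('u \<Rightarrow> 'u \<Rightarrow> 'u) \<Rightarrow> ('g::ab_group_add \<Rightarrow> 'u set) \<Rightarrow>
   ('f \<Rightarrow> 'v::ab_group_add \<Rightarrow> 'v) \<Rightarrow> ('v \<Rightarrow> 'v \<Rightarrow> 'v) \<Rightarrow> ('g \<Rightarrow> 'v set) \<Rightarrow> bool" where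
  "graded_isomorphic sU mU cU sV mV cV \<longleftrightarrow>
     (\<exists>\<psi>. Vector_Spaces.linear sU sV \<psi> \<and> bij \<psi> \<and>
          (\<forall>x y. \<psi> (mU x y) = mV (\<psi> x) (\<psi> y)) \<and>
          (\<forall>g. \<psi> ` cU g = cV g))"

end

theory Submission
  imports Defs "HOL-Combinatorics.Permutations" "HOL-Library.Function_Algebras"
begin

text \<open>An isomorphism transports evaluations, so it preserves identities. For the converse,
  choose a finite set \<open>J\<close> of indices with degrees and a homogeneous basis of \<open>U\<close> indexed by
  \<open>J\<close>. The structure constants of such a basis determine the graded algebra up to isomorphism
  (\<open>graded_isomorphic_of_struct_const\<close>). So it is enough to find a basis of \<open>U\<close> and a basis of
  \<open>V\<close>, both indexed by \<open>J\<close>, with the same structure constants. The proof compares the sets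
  \<open>S\<^sub>U\<close> and \<open>S\<^sub>V\<close> of structure constants of all such bases.

  The identities determine the Zariski closures of these sets. A graded simple algebra has no
  proper homogeneous ideals, so the operators composed of left and right multiplications act
  transitively on nonzero homogeneous elements. Over an algebraically closed field they even
  act densely on each component, by the arguments of Schur and Jacobson (\<open>mop_density\<close>).
  Density yields alternators, which are graded polynomials that behave like determinants: they
  vanish at all assignments that are not bases, they can be chosen to be nonzero at a given
  basis, and replacing the variable \<open>x\<^sub>k\<close> in a slot by \<open>x\<^sub>i x\<^sub>j\<close> multiplies
  their value with the structure constant \<open>c\<^sub>i\<^sub>j\<^sub>k\<close> (\<open>alt_eval_combination\<close>,
  \<open>exists_alternator\<close>). Equal identities therefore first give \<open>dim U = dim V\<close>, so that \<open>V\<close> has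
  a basis indexed by \<open>J\<close> as well. Moreover, by nesting alternators, a polynomial relation
  between structure constants can be written as a graded identity (\<open>eval_realize\<close>), and so
  every relation that holds on \<open>S\<^sub>U\<close> holds on \<open>S\<^sub>V\<close> and conversely
  (\<open>structure_polynomial_transfer\<close>).

  It remains to see that two such sets with the same closure have a point in common. The set
  of bases of \<open>V\<close> is an open subset of an affine space, and \<open>S\<^sub>V\<close> is its image under a
  morphism. By Chevalley's theorem the image contains a nonempty open subset of its closure
  (\<open>structure_constants_of_generic_point\<close>). The set \<open>S\<^sub>U\<close> is dense in this closure and
  meets the open subset. The version of Chevalley's theorem that is used here extends
  homomorphisms from an integral domain to finitely many further elements of a larger domain
  (\<open>hom_extension\<close>); it replaces the Nullstellensatz.\<close>

section \<open>Extending homomorphisms into an algebraically closed field\<close>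

text \<open>Rings are given as subsets of a commutative ring, and homomorphisms as functions on
  the whole type of which only the values on the subset matter. In this way rings of
  functions, which as a type have zero divisors, can be used as integral domains after
  restriction to a suitable subset.\<close>

definition is_subring :: "'k::comm_ring_1 set \<Rightarrow> bool" where
  "is_subring A \<longleftrightarrow> 1 \<in> A \<and> (\<forall>a\<in>A. \<forall>b\<in>A. a - b \<in> A \<and> a * b \<in> A)"

definition no_zero_divisors_on :: "'k::comm_ring_1 set \<Rightarrow> bool" where
  "no_zero_divisors_on A \<longleftrightarrow> (\<forall>a\<in>A. \<forall>b\<in>A. a * b = 0 \<longrightarrow> a = 0 \<or> b = 0)"

definition ring_hom_on :: "'k::comm_ring_1 set \<Rightarrow> ('k \<Rightarrow> 'f::field) \<Rightarrow> bool" where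
  "ring_hom_on A \<phi> \<longleftrightarrow> \<phi> 1 = 1 \<and> (\<forall>a\<in>A. \<forall>b\<in>A. \<phi> (a + b) = \<phi> a + \<phi> b \<and> \<phi> (a * b) = \<phi> a * \<phi> b)"

definition coeffs_in :: "'k::comm_ring_1 set \<Rightarrow> 'k poly \<Rightarrow> bool" where
  "coeffs_in A p \<longleftrightarrow> (\<forall>i. coeff p i \<in> A)"

definition adjoin :: "'k::comm_ring_1 set \<Rightarrow> 'k \<Rightarrow> 'k set" where
  "adjoin A y = {poly p y | p. coeffs_in A p}"

lemma subring_closed:
  assumes "is_subring A"
  shows "1 \<in> A" "0 \<in> A" "a \<in> A \<Longrightarrow> b \<in> A \<Longrightarrow> a - b \<in> A" "a \<in> A \<Longrightarrow> b \<in> A \<Longrightarrow> a * b \<in> A"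
    "a \<in> A \<Longrightarrow> - a \<in> A" "a \<in> A \<Longrightarrow> b \<in> A \<Longrightarrow> a + b \<in> A"
proof -
  show 1: "1 \<in> A" and d: "\<And>a b. a \<in> A \<Longrightarrow> b \<in> A \<Longrightarrow> a - b \<in> A"
    and "a \<in> A \<Longrightarrow> b \<in> A \<Longrightarrow> a * b \<in> A"
    using assms by (auto simp: is_subring_def)
  show z: "0 \<in> A" using d[OF 1 1] by simp
  show m: "\<And>a. a \<in> A \<Longrightarrow> - a \<in> A" using d[OF z] by simp
  show "a \<in> A \<Longrightarrow> b \<in> A \<Longrightarrow> a + b \<in> A" using d[OF _ m, of a b] by simp
qed

lemma subring_power: "is_subring A \<Longrightarrow> a \<in> A \<Longrightarrow> a ^ n \<in> A"
  by (induction n) (auto intro: subring_closed)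

lemma subring_sum: "is_subring A \<Longrightarrow> (\<And>i. i \<in> I \<Longrightarrow> f i \<in> A) \<Longrightarrow> sum f I \<in> A"
  by (induction I rule: infinite_finite_induct) (auto intro: subring_closed)

lemma coeffs_in_arith:
  assumes "is_subring A"
  shows "coeffs_in A 0" "coeffs_in A 1" "c \<in> A \<Longrightarrow> coeffs_in A (monom c n)" "c \<in> A \<Longrightarrow> coeffs_in A [:c:]"
    "coeffs_in A p \<Longrightarrow> coeffs_in A q \<Longrightarrow> coeffs_in A (p + q)"
    "coeffs_in A p \<Longrightarrow> coeffs_in A q \<Longrightarrow> coeffs_in A (p - q)"
    "coeffs_in A p \<Longrightarrow> coeffs_in A q \<Longrightarrow> coeffs_in A (p * q)"
    "coeffs_in A p \<Longrightarrow> c \<in> A \<Longrightarrow> coeffs_in A (smult c p)"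
  using subring_closed[OF assms]
  by (auto simp: coeffs_in_def coeff_mult coeff_pCons intro!: subring_sum[OF assms] split: nat.splits)

lemma subring_poly:
  assumes "is_subring B" "coeffs_in B p" "y \<in> B"
  shows "poly p y \<in> B"
  using assms by (auto simp: poly_altdef coeffs_in_def intro!: subring_sum subring_closed subring_power)

lemma subring_adjoin:
  assumes "is_subring A"
  shows "is_subring (adjoin A y)" "A \<subseteq> adjoin A y" "y \<in> adjoin A y"
proof -
  show "is_subring (adjoin A y)"
    unfolding is_subring_def adjoin_def
  proof (intro conjI ballI; clarify?)
    show "\<exists>p. 1 = poly p y \<and> coeffs_in A p"
      by (rule exI[of _ 1]) (simp add: coeffs_in_arith[OF assms])
  next
    fix p q assume "coeffs_in A p" "coeffs_in A q"
    then show "\<exists>r. poly p y - poly q y = poly r y \<and> coeffs_in A r"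
      by (intro exI[of _ "p - q"]) (simp add: coeffs_in_arith[OF assms])
  next
    fix p q assume "coeffs_in A p" "coeffs_in A q"
    then show "\<exists>r. poly p y * poly q y = poly r y \<and> coeffs_in A r"
      by (intro exI[of _ "p * q"]) (simp add: coeffs_in_arith[OF assms])
  qed
  show "A \<subseteq> adjoin A y"
  proof
    fix a assume "a \<in> A"
    then show "a \<in> adjoin A y" unfolding adjoin_def
      by (intro CollectI exI[of _ "[:a:]"]) (simp add: coeffs_in_arith[OF assms])
  qed
  have "coeffs_in A (monom 1 1)" using subring_closed(1)[OF assms] coeffs_in_arith(3)[OF assms] by blast
  then show "y \<in> adjoin A y" unfolding adjoin_def
    by (intro CollectI exI[of _ "monom 1 1"]) (simp add: poly_monom)
qed

lemma adjoin_subset: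
  assumes "is_subring B" "A \<subseteq> B" "y \<in> B"
  shows "adjoin A y \<subseteq> B"
  using assms subring_poly[of B _ y] by (auto simp: adjoin_def coeffs_in_def)

text \<open>Division with remainder when the leading coefficient of the divisor is not a unit.\<close>

lemma pseudo_division_in_subring:
  assumes A: "is_subring A" and g: "coeffs_in A g" and "g \<noteq> 0" and "coeffs_in A p"
  shows "\<exists>k q r. coeffs_in A q \<and> coeffs_in A r \<and> smult (lead_coeff g ^ k) p = q * g + r
      \<and> (r = 0 \<or> degree r < degree g)"
  using \<open>coeffs_in A p\<close>
proof (induction "degree p" arbitrary: p rule: less_induct)
  case less
  note C = coeffs_in_arith[OF A]
  define l where "l = lead_coeff g"
  show ?case
  proof (cases "p = 0 \<or> degree p < degree g")
    case True
    then show ?thesis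
      by (intro exI[of _ 0] exI[of _ p]) (simp add: C less.prems)
  next
    case False
    define c where "c = lead_coeff p"
    define m where "m = degree p - degree g"
    have "c \<in> A" "l \<in> A" using less.prems g by (auto simp: c_def l_def coeffs_in_def)
    define p' where "p' = smult l p - monom c m * g"
    have p': "coeffs_in A p'" unfolding p'_def using \<open>c \<in> A\<close> \<open>l \<in> A\<close> less.prems g
      by (intro C)
    have deg: "p' = 0 \<or> degree p' < degree p"
    proof -
      have "degree p' \<le> degree p" unfolding p'_def
        by (intro degree_diff_le degree_smult_le order.trans[OF degree_mult_le])
          (use False degree_monom_le[of c m] in \<open>auto simp: m_def\<close>)
      moreover have "coeff p' (degree p) = 0"
      proof -
        have "coeff (monom c m * g) (degree p) = c * coeff g (degree p - m)"
          using False by (subst coeff_monom_mult) (simp add: m_def)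
        moreover have "degree p - m = degree g" using False by (simp add: m_def)
        ultimately have "coeff (monom c m * g) (degree p) = l * c" by (simp add: l_def mult.commute)
        then show ?thesis unfolding p'_def coeff_diff coeff_smult c_def[symmetric] by (rule right_minus_eq[THEN iffD2, OF sym])
      qed
      ultimately show ?thesis
        by (metis leading_coeff_0_iff le_less)
    qed
    show ?thesis
    proof (cases "p' = 0")
      case True
      then have "smult (l ^ 1) p = monom c m * g + 0" by (simp add: p'_def)
      then show ?thesis using C(1) C(3)[OF \<open>c \<in> A\<close>, of m] unfolding l_def by blast
    next
      case False
      with deg have "degree p' < degree p" by simp
      from less.hyps[OF this p'] obtain k q r where
        qr: "coeffs_in A q" "coeffs_in A r" "smult (l ^ k) p' = q * g + r"
          "r = 0 \<or> degree r < degree g" unfolding l_def by blast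
      have "smult (l ^ Suc k) p = smult (l ^ k) p' + smult (l ^ k) (monom c m * g)"
        by (simp add: p'_def smult_diff_right power_Suc2 del: power_Suc)
      also have "\<dots> = (q + smult (l ^ k) (monom c m)) * g + r"
        by (simp add: qr(3) algebra_simps)
      finally have "smult (l ^ Suc k) p = (q + smult (l ^ k) (monom c m)) * g + r" .
      moreover have "coeffs_in A (q + smult (l ^ k) (monom c m))"
        using qr(1) \<open>c \<in> A\<close> \<open>l \<in> A\<close> by (intro C subring_power[OF A])
      ultimately show ?thesis using qr(2,4) unfolding l_def by blast
    qed
  qed
qed

lemma ring_hom_on_arith:
  assumes "is_subring A" "ring_hom_on A \<phi>"
  shows "\<phi> 1 = 1" "\<phi> 0 = 0" "a \<in> A \<Longrightarrow> b \<in> A \<Longrightarrow> \<phi> (a + b) = \<phi> a + \<phi> b"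
    "a \<in> A \<Longrightarrow> b \<in> A \<Longrightarrow> \<phi> (a * b) = \<phi> a * \<phi> b" "a \<in> A \<Longrightarrow> b \<in> A \<Longrightarrow> \<phi> (a - b) = \<phi> a - \<phi> b"
proof -
  show "\<phi> 1 = 1" and a: "\<And>a b. a \<in> A \<Longrightarrow> b \<in> A \<Longrightarrow> \<phi> (a + b) = \<phi> a + \<phi> b"
    and "a \<in> A \<Longrightarrow> b \<in> A \<Longrightarrow> \<phi> (a * b) = \<phi> a * \<phi> b"
    using assms(2) by (auto simp: ring_hom_on_def)
  have z: "0 \<in> A" using subring_closed[OF assms(1)] by blast
  show "\<phi> 0 = 0" 
  proof -
    have "\<phi> 0 + \<phi> 0 = \<phi> 0 + 0" using a[OF z z] by (simp only: add_0_right)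
    then show ?thesis by (rule add_left_imp_eq)
  qed
  show "a \<in> A \<Longrightarrow> b \<in> A \<Longrightarrow> \<phi> (a - b) = \<phi> a - \<phi> b"
    using a[of "a - b" b] subring_closed[OF assms(1)] by simp
qed

lemma ring_hom_on_sum:
  assumes "is_subring A" "ring_hom_on A \<phi>" "\<And>i. i \<in> I \<Longrightarrow> f i \<in> A"
  shows "\<phi> (sum f I) = (\<Sum>i\<in>I. \<phi> (f i))"
  using assms(3)
  by (induction I rule: infinite_finite_induct)
    (simp_all add: ring_hom_on_arith[OF assms(1,2)] subring_sum[OF assms(1)])

lemma ring_hom_on_map_poly:
  assumes A: "is_subring A" and h: "ring_hom_on A \<phi>" and p: "coeffs_in A p" and q: "coeffs_in A q"
  shows "map_poly \<phi> (p + q) = map_poly \<phi> p + map_poly \<phi> q"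
    "map_poly \<phi> (p - q) = map_poly \<phi> p - map_poly \<phi> q"
    "map_poly \<phi> (p * q) = map_poly \<phi> p * map_poly \<phi> q"
    "c \<in> A \<Longrightarrow> map_poly \<phi> (smult c p) = smult (\<phi> c) (map_poly \<phi> p)"
proof -
  note H = ring_hom_on_arith[OF A h] and S = subring_closed[OF A]
  show "map_poly \<phi> (p + q) = map_poly \<phi> p + map_poly \<phi> q"
    "map_poly \<phi> (p - q) = map_poly \<phi> p - map_poly \<phi> q"
    "c \<in> A \<Longrightarrow> map_poly \<phi> (smult c p) = smult (\<phi> c) (map_poly \<phi> p)"
    using p q by (auto simp: poly_eq_iff coeff_map_poly H coeffs_in_def)
  show "map_poly \<phi> (p * q) = map_poly \<phi> p * map_poly \<phi> q"
    using p q unfolding poly_eq_iff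
    by (auto simp: coeff_map_poly H coeffs_in_def coeff_mult S ring_hom_on_sum[OF A h])
qed

text \<open>The homomorphism sends \<open>y\<close> to \<open>t\<close>. It is well defined because every relation of \<open>y\<close>
  over \<open>A\<close> becomes a relation of \<open>t\<close>.\<close>

lemma hom_extends_to_adjoin:
  fixes \<phi> :: "'k::comm_ring_1 \<Rightarrow> 'f::field"
  assumes A: "is_subring A" and h: "ring_hom_on A \<phi>"
    and wd: "\<And>p. coeffs_in A p \<Longrightarrow> poly p y = 0 \<Longrightarrow> poly (map_poly \<phi> p) t = 0"
  shows "\<exists>\<psi>. ring_hom_on (adjoin A y) \<psi> \<and> (\<forall>a\<in>A. \<psi> a = \<phi> a)
    \<and> (\<forall>p. coeffs_in A p \<longrightarrow> \<psi> (poly p y) = poly (map_poly \<phi> p) t)"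
proof -
  note H = ring_hom_on_arith[OF A h] and C = coeffs_in_arith[OF A]
  define \<psi> where "\<psi> x = poly (map_poly \<phi> (SOME p. coeffs_in A p \<and> poly p y = x)) t" for x
  have \<psi>: "\<psi> (poly p y) = poly (map_poly \<phi> p) t" if p: "coeffs_in A p" for p
  proof -
    define q where "q = (SOME q. coeffs_in A q \<and> poly q y = poly p y)"
    have q: "coeffs_in A q \<and> poly q y = poly p y"
      unfolding q_def by (rule someI[of _ p]) (use p in simp)
    have "poly (map_poly \<phi> (q - p)) t = 0" using q p by (intro wd) (auto intro: C)
    then show ?thesis
      using q p by (simp add: \<psi>_def q_def[symmetric] ring_hom_on_map_poly[OF A h])
  qed
  have const: "\<psi> a = \<phi> a" if "a \<in> A" for a
    using \<psi>[OF C(4)[OF that]] by (simp add: map_poly_pCons H)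
  have "ring_hom_on (adjoin A y) \<psi>"
    unfolding ring_hom_on_def
  proof (intro conjI ballI)
    show "\<psi> 1 = 1" using const[OF subring_closed(1)[OF A]] H by simp
    fix a b assume "a \<in> adjoin A y" "b \<in> adjoin A y"
    then obtain p q where pq: "coeffs_in A p" "coeffs_in A q" "a = poly p y" "b = poly q y"
      by (auto simp: adjoin_def)
    show "\<psi> (a + b) = \<psi> a + \<psi> b" "\<psi> (a * b) = \<psi> a * \<psi> b"
      using \<psi>[OF C(5)[OF pq(1,2)]] \<psi>[OF C(7)[OF pq(1,2)]] \<psi>[OF pq(1)] \<psi>[OF pq(2)] pq
      by (simp_all add: ring_hom_on_map_poly[OF A h])
  qed
  then show ?thesis using const \<psi> by blast
qed

text \<open>The product of all \<open>X - x\<close>, increased by \<open>1\<close>, would have no root if the field were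
  finite.\<close>

lemma infinite_alg_closed: "infinite (UNIV :: 'f::alg_closed_field set)"
proof
  assume fin: "finite (UNIV :: 'f set)"
  define p :: "'f poly" where "p = (\<Prod>x\<in>UNIV. [:-x, 1:]) + 1"
  have "\<And>x. poly p x = 1" using fin by (simp add: p_def poly_prod) 
  moreover have "degree (\<Prod>x\<in>UNIV. [:-x, 1::'f:]) = card (UNIV :: 'f set)"
    by (subst degree_prod_eq_sum_degree) auto
  then have "degree p > 0" 
    using fin by (simp add: p_def degree_add_eq_left card_gt_0_iff)
  ultimately show False using alg_closed_imp_poly_has_root[of p] by auto
qed

lemma poly_nonroot:
  fixes p :: "'f::alg_closed_field poly"
  assumes "p \<noteq> 0"
  shows "\<exists>t. poly p t \<noteq> 0"
  using poly_roots_finite[OF assms] infinite_alg_closed[where 'f='f] by (metis (mono_tags, lifting) UNIV_eq_I mem_Collect_eq)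

text \<open>The element \<open>a\<close> collects what must not vanish. If \<open>y\<close> satisfies no relation over \<open>A\<close>,
  then \<open>y\<close> can be sent to any element of the field, and one nonzero coefficient of a
  polynomial \<open>f\<close> with \<open>f(y) = b\<close> leaves an element at which the image of \<open>f\<close> does not vanish.
  Otherwise let \<open>p\<close> be a relation of least degree, with leading coefficient \<open>l\<close>. If \<open>l\<close>
  survives, the image of \<open>p\<close> has a root, and this root satisfies all the relations of \<open>y\<close>,
  since these are divisible by \<open>p\<close> up to powers of \<open>l\<close>. In order that \<open>b\<close> survives, \<open>a\<close> is
  multiplied with a nonzero element of \<open>A\<close> that is a multiple of \<open>b\<close>.\<close>

lemma hom_extension_one_step:
  fixes A B :: "'k::comm_ring_1 set"
  assumes A: "is_subring A" and AB: "A \<subseteq> B" and B: "is_subring B" and dom: "no_zero_divisors_on B"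
    and y: "y \<in> B" and b: "b \<in> adjoin A y" "b \<noteq> 0"
  shows "\<exists>a\<in>A. a \<noteq> 0 \<and> (\<forall>\<phi> :: 'k \<Rightarrow> 'f::alg_closed_field. ring_hom_on A \<phi> \<longrightarrow> \<phi> a \<noteq> 0 \<longrightarrow>
     (\<exists>\<psi>. ring_hom_on (adjoin A y) \<psi> \<and> (\<forall>x\<in>A. \<psi> x = \<phi> x) \<and> \<psi> b \<noteq> 0))"
proof -
  note C = coeffs_in_arith[OF A] and S = subring_closed[OF A]
  have dom': "a * c \<noteq> 0" if "a \<in> B" "c \<in> B" "a \<noteq> 0" "c \<noteq> 0" for a c
    using dom that by (auto simp: no_zero_divisors_on_def)
  have inB: "poly p y \<in> B" if "coeffs_in A p" for p
    using that AB y by (intro subring_poly[OF B]) (auto simp: coeffs_in_def)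
  have pow: "a ^ n \<noteq> 0" if "a \<in> B" "a \<noteq> 0" for a n
  proof (induction n)
    case 0
    have "(1::'k) \<noteq> 0" by simp
    then show ?case by simp
  next
    case (Suc n)
    then show ?case using dom'[of a "a ^ n"] that subring_power[OF B] by simp
  qed
  obtain f where f: "coeffs_in A f" "b = poly f y" using b by (auto simp: adjoin_def)
  show ?thesis
  proof (cases "\<exists>p. coeffs_in A p \<and> p \<noteq> 0 \<and> poly p y = 0")
    case False
    have "f \<noteq> 0" using b f by auto
    define a where "a = lead_coeff f"
    have a: "a \<in> A" "a \<noteq> 0" using f \<open>f \<noteq> 0\<close> by (auto simp: a_def coeffs_in_def)
    have "\<exists>\<psi>. ring_hom_on (adjoin A y) \<psi> \<and> (\<forall>x\<in>A. \<psi> x = \<phi> x) \<and> \<psi> b \<noteq> 0"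
      if h: "ring_hom_on A \<phi>" and "\<phi> a \<noteq> 0" for \<phi> :: "'k \<Rightarrow> 'f"
    proof -
      have "coeff (map_poly \<phi> f) (degree f) \<noteq> 0"
        using that by (simp add: coeff_map_poly ring_hom_on_arith[OF A h] a_def)
      then have "map_poly \<phi> f \<noteq> 0" by auto
      then obtain t where t: "poly (map_poly \<phi> f) t \<noteq> 0" using poly_nonroot by blast
      have "poly (map_poly \<phi> p) t = 0" if "coeffs_in A p" "poly p y = 0" for p
        using that False by fastforce
      from hom_extends_to_adjoin[OF A h this] t f show ?thesis by metis
    qed
    then show ?thesis using a by blast
  next
    case True
    define isrel where "isrel p \<longleftrightarrow> coeffs_in A p \<and> p \<noteq> 0 \<and> poly p y = 0" for p
    have "\<exists>p. isrel p" using True by (simp add: isrel_def)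
    then obtain p where "isrel p" and pmin: "\<And>q. isrel q \<Longrightarrow> degree p \<le> degree q"
      using ex_has_least_nat[of isrel _ degree] by blast
    then have p: "coeffs_in A p" "p \<noteq> 0" "poly p y = 0" by (auto simp: isrel_def)
    have min0: "q = 0" if "coeffs_in A q" "poly q y = 0" "degree q < degree p" for q
      using pmin[of q] that by (auto simp: isrel_def)
    define l where "l = lead_coeff p"
    have l: "l \<in> A" "l \<noteq> 0" using p by (auto simp: l_def coeffs_in_def)
    have pdeg: "degree p > 0"
    proof (rule ccontr)
      assume "\<not> degree p > 0"
      then obtain c where "p = [:c:]" using degree_eq_zeroE by blast
      then show False using p by auto
    qed
    (* The ideal b A[y] contains a nonzero element of A: it is the value at y of a polynomial r of
       least degree with values in that ideal. If r had positive degree, dividing p by r would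
       give a relation of y of smaller degree than p. *)
    define isrep where "isrep r \<longleftrightarrow> coeffs_in A r \<and> poly r y \<noteq> 0 \<and> (\<exists>b'\<in>adjoin A y. poly r y = b * b')" for r
    have "isrep f" unfolding isrep_def using f b subring_closed(1)[OF subring_adjoin(1)[OF A]] by force
    then obtain r where r: "isrep r" and rmin: "\<And>q. isrep q \<Longrightarrow> degree r \<le> degree q"
      using ex_has_least_nat[of isrep f degree] by blast
    then obtain b' where b': "b' \<in> adjoin A y" "poly r y = b * b'" "poly r y \<noteq> 0" "coeffs_in A r"
      by (auto simp: isrep_def)
    have rnz: "r \<noteq> 0" using b' by auto
    have Br: "is_subring (adjoin A y)" by (rule subring_adjoin[OF A])
    have "degree r < degree p"
    proof -
      obtain k q s where s: "coeffs_in A q" "coeffs_in A s" "smult (l ^ k) r = q * p + s"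
        "s = 0 \<or> degree s < degree p"
        using pseudo_division_in_subring[OF A p(1,2) b'(4)] unfolding l_def by blast
      have "poly (smult (l ^ k) r) y = poly s y" using s(3) p(3) by simp
      then have e: "poly s y = l ^ k * poly r y" by simp
      have "poly s y \<noteq> 0" unfolding e using b' pow[of l k] l AB inB[of r]
        by (intro dom') (auto intro: subring_power[OF B])
      moreover have "poly s y = b * (l ^ k * b')" unfolding e b'(2) by (simp add: mult_ac)
      moreover have "l ^ k * b' \<in> adjoin A y"
        using l b' subring_adjoin[OF A] subring_power[OF A] subring_closed(4)[OF Br] by blast
      ultimately have "isrep s" using s by (auto simp: isrep_def)
      then have "degree r \<le> degree s" by (rule rmin)
      moreover have "s \<noteq> 0" using \<open>poly s y \<noteq> 0\<close> by auto
      ultimately show ?thesis using s by auto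
    qed
    have "degree r = 0"
    proof (rule ccontr)
      assume rpos: "degree r \<noteq> 0"
      define m where "m = lead_coeff r"
      have m: "m \<in> A" "m \<noteq> 0" using b' rnz by (auto simp: m_def coeffs_in_def)
      obtain k q s where s: "coeffs_in A q" "coeffs_in A s" "smult (m ^ k) p = q * r + s"
        "s = 0 \<or> degree s < degree r"
        using pseudo_division_in_subring[OF A b'(4) rnz p(1)] unfolding m_def by blast
      have "poly (smult (m ^ k) p) y = 0" using p(3) by simp
      then have "poly q y * poly r y + poly s y = 0" using s(3) by simp
      then have e: "poly s y = b * (- poly q y * b')" unfolding b'(2) by (simp add: algebra_simps eq_neg_iff_add_eq_0)
      have "- poly q y * b' \<in> adjoin A y" using s b' by (intro subring_closed[OF Br]) (auto simp: adjoin_def)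
      then have "isrep s" if "poly s y \<noteq> 0" using that s(2) e unfolding isrep_def by (intro conjI bexI[of _ "- poly q y * b'"])
      then have "poly s y = 0"
        using rmin[of s] s(4) rpos by fastforce
      with \<open>degree r < degree p\<close> s have "s = 0" using min0[of s] by auto
      have "poly q y * poly r y = 0" using \<open>poly s y = 0\<close> \<open>poly q y * poly r y + poly s y = 0\<close> by simp
      then have "poly q y = 0" using dom'[of "poly q y" "poly r y"] inB b' s by blast
      (* degrees add up in q * r since leading coefficients in B are not zero divisors *)
      have lm: "m ^ k * l \<noteq> 0" using m l AB pow by (intro dom') (auto intro: subring_power[OF B])
      have q0: "q \<noteq> 0"
      proof
        assume "q = 0"
        then have "smult (m ^ k) p = 0" using s \<open>s = 0\<close> by simp
        then have "coeff (smult (m ^ k) p) (degree p) = 0" by simp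
        then show False using lm by (simp add: l_def)
      qed
      have "lead_coeff q * lead_coeff r \<noteq> 0" using q0 rnz s b' AB
        by (intro dom') (auto simp: coeffs_in_def)
      then have "degree (q * r) = degree q + degree r" 
        by (metis coeff_mult_degree_sum degree_mult_le le_antisym le_degree)
      moreover have "degree (q * r) \<le> degree p" using s(3) \<open>s = 0\<close> by (metis add.right_neutral degree_smult_le)
      ultimately have "degree q < degree p" using rpos by linarith
      then show False using min0 s q0 \<open>poly q y = 0\<close> by blast
    qed
    then obtain a1 where "r = [:a1:]" using degree_eq_zeroE by blast
    then have a1: "a1 \<in> A" "a1 \<noteq> 0" "a1 = b * b'" using b' by (auto simp: coeffs_in_def dest: spec[of _ 0])
    have "\<exists>\<psi>. ring_hom_on (adjoin A y) \<psi> \<and> (\<forall>x\<in>A. \<psi> x = \<phi> x) \<and> \<psi> b \<noteq> 0"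
      if h: "ring_hom_on A \<phi>" and nz: "\<phi> (l * a1) \<noteq> 0" for \<phi> :: "'k \<Rightarrow> 'f"
    proof -
      note H = ring_hom_on_arith[OF A h]
      have nz': "\<phi> l \<noteq> 0" "\<phi> a1 \<noteq> 0" using nz l a1 H by auto
      have "coeff (map_poly \<phi> p) (degree p) \<noteq> 0"
        using nz' by (simp add: coeff_map_poly H l_def)
      then have "degree (map_poly \<phi> p) > 0" using pdeg le_degree by fastforce
      then obtain t where t: "poly (map_poly \<phi> p) t = 0" using alg_closed_imp_poly_has_root by blast
      have wd: "poly (map_poly \<phi> g) t = 0" if g: "coeffs_in A g" "poly g y = 0" for g
      proof -
        obtain k q s where s: "coeffs_in A q" "coeffs_in A s" "smult (l ^ k) g = q * p + s"
          "s = 0 \<or> degree s < degree p"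
          using pseudo_division_in_subring[OF A p(1,2) g(1)] unfolding l_def by blast
        have "poly (smult (l ^ k) g) y = poly s y" using s(3) p(3) by simp
        then have "poly s y = 0" using g by simp
        then have "s = 0" using s min0 by blast
        then have "map_poly \<phi> (smult (l ^ k) g) = map_poly \<phi> (q * p)" using s by simp
        then have "smult (\<phi> (l ^ k)) (map_poly \<phi> g) = map_poly \<phi> q * map_poly \<phi> p"
          unfolding ring_hom_on_map_poly(3)[OF A h s(1) p(1)]
            ring_hom_on_map_poly(4)[OF A h g(1) g(1) subring_power[OF A l(1)]] .
        then have "\<phi> (l ^ k) * poly (map_poly \<phi> g) t = 0" using t by (metis mult_zero_right poly_mult poly_smult)
        moreover have "\<phi> (l ^ k) = \<phi> l ^ k" by (induction k) (simp_all add: H l subring_power[OF A])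
        ultimately show ?thesis using nz' by simp
      qed
      from hom_extends_to_adjoin[OF A h wd] obtain \<psi> where
        \<psi>: "ring_hom_on (adjoin A y) \<psi>" "\<forall>a\<in>A. \<psi> a = \<phi> a" by blast
      have "\<psi> (b * b') = \<psi> b * \<psi> b'" using \<psi>(1) b b' by (simp add: ring_hom_on_def)
      then have "\<psi> b \<noteq> 0" using \<psi>(2) a1 nz' by auto
      then show ?thesis using \<psi> by blast
    qed
    moreover have "l * a1 \<in> A" using l a1 by (intro S)
    moreover have "l * a1 \<noteq> 0" using l a1 AB by (intro dom') auto
    ultimately show ?thesis by blast
  qed
qed

primrec adjoin_list :: "'k::comm_ring_1 set \<Rightarrow> 'k list \<Rightarrow> 'k set" where
  "adjoin_list A [] = A"
| "adjoin_list A (y # ys) = adjoin_list (adjoin A y) ys"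

lemma subring_adjoin_list:
  assumes "is_subring A"
  shows "is_subring (adjoin_list A ys) \<and> A \<union> set ys \<subseteq> adjoin_list A ys"
  using assms
proof (induction ys arbitrary: A)
  case (Cons y ys)
  then show ?case using Cons.IH[OF subring_adjoin(1)[OF Cons.prems]] subring_adjoin[OF Cons.prems, of y]
    by (metis adjoin_list.simps(2) Un_least insert_subset le_sup_iff list.simps(15) subset_trans subsetD)
qed auto

text \<open>This is an algebraic form of Chevalley's theorem that the image of a dominant morphism
  of varieties contains a nonempty open set: a point of \<open>A\<close> outside the zero set of \<open>a\<close> lifts
  to \<open>A[ys]\<close>. The adjoined elements are treated one by one, and the element \<open>a\<close> of a later
  step is the \<open>b\<close> of the step before.\<close>

theorem hom_extension:
  fixes A B :: "'k::comm_ring_1 set"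
  assumes "is_subring A" "A \<subseteq> B" and B: "is_subring B" "no_zero_divisors_on B"
    and "set ys \<subseteq> B" "b \<in> adjoin_list A ys" "b \<noteq> 0"
  shows "\<exists>a\<in>A. a \<noteq> 0 \<and> (\<forall>\<phi> :: 'k \<Rightarrow> 'f::alg_closed_field. ring_hom_on A \<phi> \<longrightarrow> \<phi> a \<noteq> 0 \<longrightarrow>
     (\<exists>\<psi>. ring_hom_on (adjoin_list A ys) \<psi> \<and> (\<forall>x\<in>A. \<psi> x = \<phi> x) \<and> \<psi> b \<noteq> 0))"
  using assms(1,2,5-7)
proof (induction ys arbitrary: A)
  case Nil
  then show ?case by auto
next
  case (Cons y ys)
  have 1: "is_subring (adjoin A y)" "A \<subseteq> adjoin A y" by (rule subring_adjoin[OF Cons.prems(1)])+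
  have 2: "adjoin A y \<subseteq> B" using Cons.prems by (intro adjoin_subset B) auto
  obtain a1 where a1: "a1 \<in> adjoin A y" "a1 \<noteq> 0" and ext1: "\<And>\<phi> :: 'k \<Rightarrow> 'f. ring_hom_on (adjoin A y) \<phi> \<Longrightarrow>
      \<phi> a1 \<noteq> 0 \<Longrightarrow> \<exists>\<psi>. ring_hom_on (adjoin_list (adjoin A y) ys) \<psi> \<and> (\<forall>x\<in>adjoin A y. \<psi> x = \<phi> x) \<and> \<psi> b \<noteq> 0"
    using Cons.IH[OF 1(1) 2] Cons.prems by auto
  obtain a where a: "a \<in> A" "a \<noteq> 0" and ext: "\<And>\<phi> :: 'k \<Rightarrow> 'f. ring_hom_on A \<phi> \<Longrightarrow>
      \<phi> a \<noteq> 0 \<Longrightarrow> \<exists>\<psi>. ring_hom_on (adjoin A y) \<psi> \<and> (\<forall>x\<in>A. \<psi> x = \<phi> x) \<and> \<psi> a1 \<noteq> 0"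
    using hom_extension_one_step[OF Cons.prems(1,2) B _ a1] Cons.prems by auto
  have "\<exists>\<psi>. ring_hom_on (adjoin_list A (y # ys)) \<psi> \<and> (\<forall>x\<in>A. \<psi> x = \<phi> x) \<and> \<psi> b \<noteq> 0"
    if \<phi>: "ring_hom_on A \<phi>" "\<phi> a \<noteq> 0" for \<phi> :: "'k \<Rightarrow> 'f"
  proof -
    obtain \<phi>1 where \<phi>1: "ring_hom_on (adjoin A y) \<phi>1" "\<forall>x\<in>A. \<phi>1 x = \<phi> x" "\<phi>1 a1 \<noteq> 0"
      using ext[OF \<phi>] by blast
    obtain \<psi> where "ring_hom_on (adjoin_list (adjoin A y) ys) \<psi>" "\<forall>x\<in>adjoin A y. \<psi> x = \<phi>1 x" "\<psi> b \<noteq> 0"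
      using ext1[OF \<phi>1(1,3)] by blast
    then show ?thesis using \<phi>1(2) 1(2) by (intro exI[of _ \<psi>]) auto
  qed
  then show ?case using a by blast
qed

section \<open>Eigenvectors\<close>

text \<open>Let \<open>n\<close> be least such that \<open>T\<^sup>n v\<close> is a combination of the earlier iterates.
  This combination gives a monic polynomial \<open>p\<close> of degree \<open>n\<close> with \<open>p(T) v = 0\<close>. For a root
  \<open>r\<close> of \<open>p = (X - r) q\<close>, the vector \<open>q(T) v\<close> is an eigenvector; it is nonzero because \<open>n\<close> is
  least.\<close>

lemma eigenvector_exists:
  fixes scale :: "'f::alg_closed_field \<Rightarrow> 'u::ab_group_add \<Rightarrow> 'u"
  assumes fd: "finite_dimensional_vector_space scale B" and S: "module.subspace scale S"
    and T: "\<And>x. x \<in> S \<Longrightarrow> T x \<in> S"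
    and Tadd: "\<And>x y. x \<in> S \<Longrightarrow> y \<in> S \<Longrightarrow> T (x + y) = T x + T y"
    and Tscale: "\<And>c x. x \<in> S \<Longrightarrow> T (scale c x) = scale c (T x)"
    and v: "v \<in> S" "v \<noteq> 0"
  shows "\<exists>r w. w \<in> S \<and> w \<noteq> 0 \<and> T w = scale r w"
proof -
  interpret finite_dimensional_vector_space scale B by (rule fd)
  define t where "t i = (T ^^ i) v" for i
  have tS: "t i \<in> S" for i unfolding t_def by (induction i) (use v T in simp_all)
  have tSuc: "t (Suc i) = T (t i)" for i by (simp add: t_def)
  have "\<exists>n. t n \<in> span (t ` {..<n})"
  proof (rule ccontr)
    assume no: "\<not> ?thesis"
    have "independent (t ` {..<n}) \<and> card (t ` {..<n}) = n" for n
    proof (induction n)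
      case (Suc n)
      have 1: "t n \<notin> span (t ` {..<n})" using no by (rule contrapos_nn) (rule exI)
      have 2: "t n \<notin> t ` {..<n}" using 1 by (rule contrapos_nn) (rule span_base)
      have 3: "independent (t ` {..<n})" "card (t ` {..<n}) = n" using Suc.IH by simp_all
      show ?case unfolding lessThan_Suc image_insert
      proof
        show "independent (insert (t n) (t ` {..<n}))" by (rule independent_insertI[OF 1 3(1)])
        show "card (insert (t n) (t ` {..<n})) = Suc n"
          by (subst card_insert_disjoint[OF _ 2]) (rule finite_imageI[OF finite_lessThan], rule arg_cong[OF 3(2)])
      qed
    qed (simp add: independent_empty)
    from this[of "Suc (dim UNIV)"] have i: "independent (t ` {..<Suc (dim UNIV)})"
      and c: "card (t ` {..<Suc (dim UNIV)}) = Suc (dim UNIV)" by blast+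
    have "card (t ` {..<Suc (dim UNIV)}) \<le> dim UNIV"
      by (rule independent_card_le_dim[OF subset_UNIV i])
    then show False unfolding c by simp
  qed
  then obtain n0 where n0: "t n0 \<in> span (t ` {..<n0})" ..
  define n where "n = (LEAST n. t n \<in> span (t ` {..<n}))"
  have n: "t n \<in> span (t ` {..<n})" unfolding n_def by (rule LeastI[of _ n0]) (rule n0)
  have nmin: "t m \<notin> span (t ` {..<m})" if "m < n" for m using not_less_Least that unfolding n_def by blast
  have npos: "n > 0" using n v by (cases n) (auto simp: t_def)
  have comb: "x \<in> span (t ` {..<m}) \<Longrightarrow> \<exists>c. x = (\<Sum>i<m. scale (c i) (t i))" for x m
  proof (induction m arbitrary: x)
    case (Suc m)
    then obtain k where "x - scale k (t m) \<in> span (t ` {..<m})"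
      unfolding lessThan_Suc image_insert span_breakdown_eq by blast
    then obtain c where c: "x - scale k (t m) = (\<Sum>i<m. scale (c i) (t i))" using Suc.IH by blast
    have "(\<Sum>i<m. scale ((c(m := k)) i) (t i)) = (\<Sum>i<m. scale (c i) (t i))"
      by (intro sum.cong) auto
    then have "x = (\<Sum>i<Suc m. scale ((c(m := k)) i) (t i))" using c by (simp add: algebra_simps)
    then show ?case by blast
  qed auto
  obtain c where c: "t n = (\<Sum>i<n. scale (c i) (t i))" using comb[OF n] by blast
  define p where "p = monom 1 n - (\<Sum>i<n. monom (c i) i)"
  have pc: "coeff p i = (if i = n then 1 else if i < n then - c i else 0)" for i
    by (simp add: p_def coeff_sum)
  have pdeg: "degree p = n" 
    by (rule antisym[OF degree_le le_degree]) (auto simp: pc)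
  obtain r where "poly p r = 0" using alg_closed_imp_poly_has_root[of p] npos pdeg by auto
  then have "[:-r, 1:] dvd p" by (simp add: poly_eq_0_iff_dvd)
  then obtain q where q: "p = [:-r, 1:] * q" by (rule dvdE)
  have "p \<noteq> 0" using pdeg npos by auto
  then have "q \<noteq> 0" using q by auto
  then have qdeg: "n = Suc (degree q)" using pdeg q degree_mult_eq[of "[:-r, 1:]" q] by simp
  have rec: "coeff p i = (case i of 0 \<Rightarrow> 0 | Suc j \<Rightarrow> coeff q j) - r * coeff q i" for i
    by (simp add: q coeff_pCons split: nat.splits)
  (* w = q(T) v, so that (T - r) w = p(T) v = 0 *)
  define w where "w = (\<Sum>i<n. scale (coeff q i) (t i))"
  have sumS: "(\<Sum>i<m. scale (d i) (t i)) \<in> S" for d m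
    by (intro subspace_sum[OF S] subspace_scale[OF S] tS)
  have T0: "T 0 = 0" using Tadd[of 0 0] subspace_0[OF S] by simp
  have Tsum: "T (\<Sum>i<m. scale (d i) (t i)) = (\<Sum>i<m. scale (d i) (t (Suc i)))" for d m
    by (induction m) (simp_all add: T0 Tadd Tscale sumS tS subspace_scale[OF S] tSuc)
  have qn: "coeff q n = 0" using qdeg by (intro coeff_eq_0) simp
  have "T w = (\<Sum>i<Suc n. scale (case i of 0 \<Rightarrow> 0 | Suc j \<Rightarrow> coeff q j) (t i))"
    unfolding w_def Tsum by (subst sum.lessThan_Suc_shift) simp
  moreover have "scale r w = (\<Sum>i<Suc n. scale (r * coeff q i) (t i))"
    by (simp add: w_def scale_sum_right qn)
  ultimately have "T w - scale r w = (\<Sum>i<Suc n. scale (coeff p i) (t i))"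
    by (simp only: rec scale_left_diff_distrib sum_subtractf)
  also have "\<dots> = 0" by (simp add: pc c sum_negf)
  finally have eig: "T w = scale r w" by simp
  have "w \<noteq> 0"
  proof
    assume "w = 0"
    have lead: "coeff q (degree q) = 1" using rec[of "Suc (degree q)"] pc[of n] qn unfolding qdeg[symmetric]
      by (simp add: qdeg)
    from \<open>w = 0\<close> have "t (degree q) = - (\<Sum>i<degree q. scale (coeff q i) (t i))"
      unfolding w_def qdeg by (simp add: lead eq_neg_iff_add_eq_0 add.commute)
    also have "\<dots> \<in> span (t ` {..<degree q})"
      by (intro span_neg span_sum span_scale span_base) auto
    finally show False using nmin[of "degree q"] qdeg by simp
  qed
  then show ?thesis using eig sumS w_def by blast
qed

section \<open>Evaluation of polynomials\<close>

text \<open>With these operations the finitely supported functions on the free magma form the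
  algebra \<open>F{X}\<close>, and \<open>eval_poly\<close> is a homomorphism from it to each graded algebra.\<close>

definition pvar :: "'x \<Rightarrow> 'x magma \<Rightarrow>\<^sub>0 'f::comm_ring_1" where
  "pvar x = Poly_Mapping.single (Var x) 1"

definition pscale :: "'f::comm_ring_1 \<Rightarrow> ('x magma \<Rightarrow>\<^sub>0 'f) \<Rightarrow> ('x magma \<Rightarrow>\<^sub>0 'f)" where
  "pscale c f = (\<Sum>t\<in>Poly_Mapping.keys f. Poly_Mapping.single t (c * Poly_Mapping.lookup f t))"

definition pmul :: "('x magma \<Rightarrow>\<^sub>0 'f::comm_ring_1) \<Rightarrow> ('x magma \<Rightarrow>\<^sub>0 'f) \<Rightarrow> ('x magma \<Rightarrow>\<^sub>0 'f)" where
  "pmul f h = (\<Sum>s\<in>Poly_Mapping.keys f. \<Sum>t\<in>Poly_Mapping.keys h.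
     Poly_Mapping.single (Prod s t) (Poly_Mapping.lookup f s * Poly_Mapping.lookup h t))"

context graded_algebra
begin

sublocale mr: Vector_Spaces.linear scale scale "\<lambda>y. mult x y" for x by (rule linear_mult_right)
sublocale ml: Vector_Spaces.linear scale scale "\<lambda>x. mult x y" for y by (rule linear_mult_left)

lemmas mult_simps = mr.add ml.add mr.scale ml.scale mr.zero ml.zero mr.diff ml.diff mr.sum ml.sum

lemma eval_poly_superset:
  assumes "finite S" "Poly_Mapping.keys f \<subseteq> S"
  shows "eval_poly u f = (\<Sum>t\<in>S. scale (Poly_Mapping.lookup f t) (eval_magma mult u t))"
  unfolding eval_poly_def using assms
  by (intro sum.mono_neutral_left) (auto simp: in_keys_iff)

lemma eval_poly_0 [simp]: "eval_poly u 0 = 0"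
  by (simp add: eval_poly_def)

lemma eval_poly_add: "eval_poly u (f + h) = eval_poly u f + eval_poly u h"
proof -
  have "Poly_Mapping.keys (f + h) \<subseteq> Poly_Mapping.keys f \<union> Poly_Mapping.keys h" by (rule keys_add)
  then show ?thesis
    using eval_poly_superset[of "Poly_Mapping.keys f \<union> Poly_Mapping.keys h" _ u]
    by (simp add: lookup_add scale_left_distrib sum.distrib)
qed

lemma eval_poly_sum: "eval_poly u (sum F I) = (\<Sum>i\<in>I. eval_poly u (F i))"
  by (induction I rule: infinite_finite_induct) (simp_all add: eval_poly_add)

lemma eval_poly_single: "eval_poly u (Poly_Mapping.single t c) = scale c (eval_magma mult u t)"
  by (subst eval_poly_superset[of "{t}"]) (auto split: if_splits)

lemma eval_poly_pvar: "eval_poly u (pvar x) = u x"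
  by (simp add: pvar_def eval_poly_single)

lemma eval_poly_pscale: "eval_poly u (pscale c f) = scale c (eval_poly u f)"
  unfolding pscale_def eval_poly_sum eval_poly_single
  by (simp add: eval_poly_def scale_sum_right)

lemma eval_poly_pmul: "eval_poly u (pmul f h) = mult (eval_poly u f) (eval_poly u h)"
proof -
  have "mult (eval_poly u f) (eval_poly u h) = (\<Sum>s\<in>Poly_Mapping.keys f. \<Sum>t\<in>Poly_Mapping.keys h.
      mult (scale (Poly_Mapping.lookup f s) (eval_magma mult u s)) (scale (Poly_Mapping.lookup h t) (eval_magma mult u t)))"
    unfolding eval_poly_def ml.sum by (simp only: mr.sum)
  also have "\<dots> = eval_poly u (pmul f h)"
    unfolding pmul_def eval_poly_sum eval_poly_single eval_magma.simps mr.scale ml.scale scale_scale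
    by (simp only: mult.commute)
  finally show ?thesis ..
qed

definition graded_assignment :: "('g \<times> nat \<Rightarrow> 'u) \<Rightarrow> bool" where
  "graded_assignment u \<longleftrightarrow> (\<forall>x. u x \<in> comp (fst x))"

lemma subspace_comp: "subspace (comp g)"
  using grading by (simp add: is_direct_sum_def)

lemma eval_magma_cong: "(\<And>x. x \<in> vars_magma t \<Longrightarrow> u x = u' x) \<Longrightarrow> eval_magma mult u t = eval_magma mult u' t"
  by (induction t) auto

lemma graded_identity_iff:
  "graded_identity f \<longleftrightarrow> (\<forall>u. graded_assignment u \<longrightarrow> eval_poly u f = 0)"
proof
  assume R: "\<forall>u. graded_assignment u \<longrightarrow> eval_poly u f = 0"
  show "graded_identity f"
    unfolding graded_identity_def
  proof (intro allI impI)
    fix u assume u: "\<forall>(g, i)\<in>vars f. u (g, i) \<in> comp g"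
    define u' where "u' x = (if x \<in> vars f then u x else 0)" for x
    have "graded_assignment u'" using u subspace_0[OF subspace_comp]
      by (auto simp: graded_assignment_def u'_def)
    moreover have "eval_poly u' f = eval_poly u f"
      unfolding eval_poly_def
      by (intro sum.cong arg_cong2[of _ _ _ _ scale] eval_magma_cong) (auto simp: u'_def vars_def)
    ultimately show "eval_poly u f = 0" using R by auto
  qed
qed (auto simp: graded_identity_def graded_assignment_def)

section \<open>Homogeneous components and homogeneous bases\<close>

definition proj :: "'g \<Rightarrow> 'u \<Rightarrow> 'u" where
  "proj g v = (THE c. (\<forall>i. c i \<in> comp i) \<and> finite {i. c i \<noteq> 0} \<and> v = (\<Sum>i | c i \<noteq> 0. c i)) g"

lemma proj_all: "(\<forall>i. proj i v \<in> comp i) \<and> finite {i. proj i v \<noteq> 0} \<and> v = (\<Sum>i | proj i v \<noteq> 0. proj i v)"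
proof -
  have "\<exists>!c. (\<forall>i. c i \<in> comp i) \<and> finite {i. c i \<noteq> 0} \<and> v = (\<Sum>i | c i \<noteq> 0. c i)"
    using grading by (auto simp: is_direct_sum_def)
  from theI'[OF this] show ?thesis unfolding proj_def by simp
qed

lemma proj_eqI:
  assumes "\<And>i. c i \<in> comp i" "finite S" "\<And>i. i \<notin> S \<Longrightarrow> c i = 0" "v = (\<Sum>i\<in>S. c i)"
  shows "proj i v = c i"
proof -
  have sub: "{i. c i \<noteq> 0} \<subseteq> S" using assms(3) by auto
  define P where "P c \<longleftrightarrow> (\<forall>i. c i \<in> comp i) \<and> finite {i. c i \<noteq> 0} \<and> v = (\<Sum>i | c i \<noteq> 0. c i)" for c
  have "P c" unfolding P_def
    using assms finite_subset[OF sub] sum.mono_neutral_left[OF assms(2) sub, of c] by auto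
  moreover have "\<exists>!c. P c"
    using grading unfolding P_def by (auto simp: is_direct_sum_def)
  moreover have "P (\<lambda>i. proj i v)" using proj_all[of v] unfolding P_def .
  ultimately have "(\<lambda>i. proj i v) = c" by blast
  then show ?thesis by meson
qed

lemma proj_sum_superset:
  assumes "finite S" "{i. proj i v \<noteq> 0} \<subseteq> S"
  shows "v = (\<Sum>i\<in>S. proj i v)"
  using proj_all[of v] sum.mono_neutral_left[OF assms, of "\<lambda>i. proj i v"] by auto

lemma linear_proj: "Vector_Spaces.linear scale scale (proj g)"
proof unfold_locales
  fix v w c
  have "finite ({i. proj i v \<noteq> 0} \<union> {i. proj i w \<noteq> 0})" (is "finite ?S") using proj_all by blast
  then have "v = (\<Sum>i\<in>?S. proj i v)" "w = (\<Sum>i\<in>?S. proj i w)"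
    by (auto intro!: proj_sum_superset)
  then have "v + w = (\<Sum>i\<in>?S. proj i v + proj i w)" unfolding sum.distrib by (rule arg_cong2)
  then show "proj g (v + w) = proj g v + proj g w"
    by (intro proj_eqI[of "\<lambda>i. proj i v + proj i w" ?S] subspace_add[OF subspace_comp])
      (use \<open>finite ?S\<close> proj_all in auto)
  have "finite {i. proj i v \<noteq> 0}" "v = (\<Sum>i | proj i v \<noteq> 0. proj i v)" using proj_all[of v] by auto
  then show "proj g (scale c v) = scale c (proj g v)"
    by (intro proj_eqI[of "\<lambda>i. scale c (proj i v)" "{i. proj i v \<noteq> 0}"] subspace_scale[OF subspace_comp])
      (use proj_all in \<open>auto simp: scale_sum_right[symmetric]\<close>)
qed

sublocale pr: Vector_Spaces.linear scale scale "proj g" for g by (rule linear_proj)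

lemma proj_comp: assumes "v \<in> comp g" shows "proj h v = (if h = g then v else 0)"
  by (rule proj_eqI[of _ "{g}"]) (use assms subspace_0[OF subspace_comp] in auto)

text \<open>A subspace spanned by homogeneous elements is homogeneous: the projections of its
  elements can be computed on the spanning set.\<close>

lemma span_of_graded_pieces:
  assumes "\<And>h. subspace (I h)" and "\<And>h. I h \<subseteq> comp h"
  shows "v \<in> span (\<Union>h. I h) \<Longrightarrow> proj h v \<in> I h" and "homogeneous (span (\<Union>h. I h))"
proof -
  show pI: "proj h v \<in> I h" if "v \<in> span (\<Union>h. I h)" for v h
    using that
  proof (induction rule: span_induct)
    case base
    show ?case by (auto simp: subspace_def pr.add pr.scale pr.zero intro!: subspace_0 subspace_add subspace_scale assms(1))
  next
    case (step x)
    then obtain g where "x \<in> I g" by blast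
    then show ?case using assms(2)[of g] proj_comp[of x g h] subspace_0[OF assms(1)[of h]] by auto
  qed
  show "homogeneous (span (\<Union>h. I h))"
    unfolding homogeneous_def is_direct_sum_def
  proof (intro conjI allI ballI)
    fix v assume v: "v \<in> span (\<Union>h. I h)"
    have pin: "proj i v \<in> span (\<Union>h. I h)" for i using pI[OF v, of i] by (intro span_base) auto
    show "\<exists>!c. (\<forall>i. c i \<in> span (\<Union>h. I h) \<inter> comp i) \<and> finite {i. c i \<noteq> 0} \<and> v = (\<Sum>i | c i \<noteq> 0. c i)"
    proof (rule ex1I[of _ "\<lambda>i. proj i v"])
      show "(\<forall>i. proj i v \<in> span (\<Union>h. I h) \<inter> comp i) \<and> finite {i. proj i v \<noteq> 0} \<and> v = (\<Sum>i | proj i v \<noteq> 0. proj i v)"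
        using proj_all[of v] pin by blast
      fix c assume "(\<forall>i. c i \<in> span (\<Union>h. I h) \<inter> comp i) \<and> finite {i. c i \<noteq> 0} \<and> v = (\<Sum>i | c i \<noteq> 0. c i)"
      then show "c = (\<lambda>i. proj i v)"
        by (intro ext proj_eqI[symmetric, of c "{i. c i \<noteq> 0}"]) blast+
    qed
  qed (auto intro!: subspace_inter subspace_comp)
qed

text \<open>A homogeneous basis is a family indexed by a finite set \<open>J\<close> of variables, where
  \<open>(g, i)\<close> indexes an element of degree \<open>g\<close>. So a basis is itself a graded assignment of the
  variables, at which graded polynomials can be evaluated, and one set \<open>J\<close> can index bases of
  two different algebras. The values outside \<open>J\<close> only have to be homogeneous of the right
  degree.\<close>

definition graded_basis :: "('g \<times> nat) set \<Rightarrow> ('g \<times> nat \<Rightarrow> 'u) \<Rightarrow> bool" where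
  "graded_basis J u \<longleftrightarrow> finite J \<and> graded_assignment u
     \<and> (\<forall>w. \<exists>c. w = (\<Sum>j\<in>J. scale (c j) (u j)))
     \<and> (\<forall>c. (\<Sum>j\<in>J. scale (c j) (u j)) = 0 \<longrightarrow> (\<forall>j\<in>J. c j = 0))"

lemma graded_basisD:
  assumes "graded_basis J u"
  shows "finite J" "graded_assignment u" "u x \<in> comp (fst x)" "\<exists>c. w = (\<Sum>j\<in>J. scale (c j) (u j))"
    "(\<Sum>j\<in>J. scale (d j) (u j)) = 0 \<Longrightarrow> j \<in> J \<Longrightarrow> d j = 0"
proof -
  show "finite J" "graded_assignment u" "\<exists>c. w = (\<Sum>j\<in>J. scale (c j) (u j))"
    using assms unfolding graded_basis_def by blast+
  then show "u x \<in> comp (fst x)" unfolding graded_assignment_def by blast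
  have "\<forall>c. (\<Sum>j\<in>J. scale (c j) (u j)) = 0 \<longrightarrow> (\<forall>j\<in>J. c j = 0)"
    using assms unfolding graded_basis_def by blast
  from this[rule_format, of d j] show "(\<Sum>j\<in>J. scale (d j) (u j)) = 0 \<Longrightarrow> j \<in> J \<Longrightarrow> d j = 0" .
qed

definition crd :: "('g \<times> nat) set \<Rightarrow> ('g \<times> nat \<Rightarrow> 'u) \<Rightarrow> 'u \<Rightarrow> 'g \<times> nat \<Rightarrow> 'f" where
  "crd J u w = (SOME c. w = (\<Sum>j\<in>J. scale (c j) (u j)))"

lemma crd_sum: "graded_basis J u \<Longrightarrow> w = (\<Sum>j\<in>J. scale (crd J u w j) (u j))"
  unfolding crd_def by (rule someI_ex[of "\<lambda>c. w = (\<Sum>j\<in>J. scale (c j) (u j))"]) (simp add: graded_basis_def)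

lemma crd_eqI:
  assumes b: "graded_basis J u" and w: "w = (\<Sum>j\<in>J. scale (c j) (u j))" and j: "j \<in> J"
  shows "crd J u w j = c j"
proof -
  have "(\<Sum>j\<in>J. scale (crd J u w j - c j) (u j)) = 0"
    using crd_sum[OF b, of w] w by (simp add: scale_left_diff_distrib sum_subtractf)
  from graded_basisD(5)[OF b this j] have "crd J u w j - c j = 0" .
  then show ?thesis by simp
qed

lemma crd_add: "graded_basis J u \<Longrightarrow> j \<in> J \<Longrightarrow> crd J u (v + w) j = crd J u v j + crd J u w j"
  by (rule crd_eqI) (auto simp: scale_left_distrib sum.distrib crd_sum[symmetric])

lemma crd_scale: "graded_basis J u \<Longrightarrow> j \<in> J \<Longrightarrow> crd J u (scale c v) j = c * crd J u v j"
  by (rule crd_eqI) (auto simp: scale_scale[symmetric] scale_sum_right[symmetric] crd_sum[symmetric] simp del: scale_scale)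

lemma crd_0: "graded_basis J u \<Longrightarrow> j \<in> J \<Longrightarrow> crd J u 0 j = 0"
  by (rule crd_eqI) auto

lemma crd_sum_dist: "graded_basis J u \<Longrightarrow> j \<in> J \<Longrightarrow> crd J u (sum f I) j = (\<Sum>i\<in>I. crd J u (f i) j)"
  by (induction I rule: infinite_finite_induct) (auto simp: crd_add crd_0)

lemma crd_ext: "graded_basis J u \<Longrightarrow> (\<And>j. j \<in> J \<Longrightarrow> crd J u v j = crd J u w j) \<Longrightarrow> v = w"
  by (subst crd_sum[of J u v], assumption, subst crd_sum[of J u w], assumption) (rule sum.cong, simp_all)

lemma crd_basis: "graded_basis J u \<Longrightarrow> j \<in> J \<Longrightarrow> i \<in> J \<Longrightarrow> crd J u (u i) j = (if j = i then 1 else 0)"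
  by (rule crd_eqI) (auto simp: graded_basis_def if_distrib[of "\<lambda>c. scale c _"] sum.delta cong: if_cong)

lemma crd_homogeneous:
  assumes b: "graded_basis J u" and w: "w \<in> comp g" and j: "j \<in> J" "fst j \<noteq> g"
  shows "crd J u w j = 0"
proof -
  let ?c = "crd J u w"
  have deg: "u i \<in> comp (fst i)" for i by (rule graded_basisD(3)[OF b])
  have "proj (fst j) w = (\<Sum>i\<in>J. scale (?c i) (proj (fst j) (u i)))"
    by (subst crd_sum[OF b, of w]) (simp add: pr.sum pr.scale)
  also have "\<dots> = (\<Sum>i\<in>J. scale (if fst i = fst j then ?c i else 0) (u i))"
    by (intro sum.cong) (auto simp: proj_comp[OF deg])
  finally have "(\<Sum>i\<in>J. scale (if fst i = fst j then ?c i else 0) (u i)) = 0"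
    using proj_comp[OF w] j by simp
  from graded_basisD(5)[OF b this j(1)] show ?thesis by simp
qed

lemma crd_sum_homogeneous:
  assumes b: "graded_basis J u" and w: "w \<in> comp g"
  shows "w = (\<Sum>j | j \<in> J \<and> fst j = g. scale (crd J u w j) (u j))"
proof -
  have "w = (\<Sum>j\<in>J. scale (crd J u w j) (u j))" by (rule crd_sum[OF b])
  also have "\<dots> = (\<Sum>j | j \<in> J \<and> fst j = g. scale (crd J u w j) (u j))"
    using b crd_homogeneous[OF b w] by (intro sum.mono_neutral_right) (auto simp: graded_basis_def)
  finally show ?thesis .
qed

end

section \<open>Multiplication operators and density\<close>

text \<open>Combinations of words in the left and right multiplications by variables. An operator
  is kept as a syntactic object because it acts both on polynomials and on every graded
  algebra: what is chosen in view of one algebra is then available as a polynomial for the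
  other one.\<close>

datatype ('x, 'f) mop = MId | MLeft 'x "('x, 'f) mop" | MRight 'x "('x, 'f) mop"
  | MAdd "('x, 'f) mop" "('x, 'f) mop" | MScale 'f "('x, 'f) mop" | MZero

primrec mop_poly :: "('x, 'f::comm_ring_1) mop \<Rightarrow> ('x magma \<Rightarrow>\<^sub>0 'f) \<Rightarrow> ('x magma \<Rightarrow>\<^sub>0 'f)" where
  "mop_poly MId f = f"
| "mop_poly (MLeft x D) f = pmul (pvar x) (mop_poly D f)"
| "mop_poly (MRight x D) f = pmul (mop_poly D f) (pvar x)"
| "mop_poly (MAdd D E) f = mop_poly D f + mop_poly E f"
| "mop_poly (MScale c D) f = pscale c (mop_poly D f)"
| "mop_poly MZero f = 0"

primrec mop_comp :: "('x, 'f::comm_ring_1) mop \<Rightarrow> ('x, 'f) mop \<Rightarrow> ('x, 'f) mop" where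
  "mop_comp MId E = E"
| "mop_comp (MLeft x D) E = MLeft x (mop_comp D E)"
| "mop_comp (MRight x D) E = MRight x (mop_comp D E)"
| "mop_comp (MAdd D D') E = MAdd (mop_comp D E) (mop_comp D' E)"
| "mop_comp (MScale c D) E = MScale c (mop_comp D E)"
| "mop_comp MZero E = MZero"

text \<open>An operator of degree \<open>d\<close> raises degrees by \<open>d\<close>; only the variables in \<open>J\<close> are allowed
  as multipliers. The zero operator has every degree.\<close>

inductive mop_deg :: "('g::ab_group_add \<times> 'n) set \<Rightarrow> ('g \<times> 'n, 'f) mop \<Rightarrow> 'g \<Rightarrow> bool" for J where
  "mop_deg J MId 0"
| "x \<in> J \<Longrightarrow> mop_deg J D d \<Longrightarrow> mop_deg J (MLeft x D) (fst x + d)"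
| "x \<in> J \<Longrightarrow> mop_deg J D d \<Longrightarrow> mop_deg J (MRight x D) (fst x + d)"
| "mop_deg J D d \<Longrightarrow> mop_deg J E d \<Longrightarrow> mop_deg J (MAdd D E) d"
| "mop_deg J D d \<Longrightarrow> mop_deg J (MScale c D) d"
| "mop_deg J MZero d"

lemma mop_deg_comp: "mop_deg J D d \<Longrightarrow> mop_deg J E e \<Longrightarrow> mop_deg J (mop_comp D E) (d + e)"
  by (induction rule: mop_deg.induct) (auto intro: mop_deg.intros simp: add.assoc)

context graded_algebra
begin

primrec mop_eval :: "('g \<times> nat \<Rightarrow> 'u) \<Rightarrow> ('g \<times> nat, 'f) mop \<Rightarrow> 'u \<Rightarrow> 'u" where
  "mop_eval u MId z = z"
| "mop_eval u (MLeft x D) z = mult (u x) (mop_eval u D z)"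
| "mop_eval u (MRight x D) z = mult (mop_eval u D z) (u x)"
| "mop_eval u (MAdd D E) z = mop_eval u D z + mop_eval u E z"
| "mop_eval u (MScale c D) z = scale c (mop_eval u D z)"
| "mop_eval u MZero z = 0"

lemma eval_mop_poly: "eval_poly u (mop_poly D f) = mop_eval u D (eval_poly u f)"
  by (induction D) (simp_all add: eval_poly_add eval_poly_pscale eval_poly_pmul eval_poly_pvar)

lemma mop_eval_comp: "mop_eval u (mop_comp D E) z = mop_eval u D (mop_eval u E z)"
  by (induction D) simp_all

lemma mop_eval_add: "mop_eval u D (y + z) = mop_eval u D y + mop_eval u D z"
  by (induction D) (simp_all add: mult_simps scale_right_distrib)

lemma mop_eval_scale: "mop_eval u D (scale c z) = scale c (mop_eval u D z)"
  by (induction D) (simp_all add: mult_simps scale_right_distrib mult.commute)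

lemma linear_mop: "Vector_Spaces.linear scale scale (mop_eval u D)"
  by unfold_locales (simp_all add: mop_eval_add mop_eval_scale)

sublocale mop: Vector_Spaces.linear scale scale "mop_eval u D" for u D by (rule linear_mop)

lemma mop_eval_comp_degree:
  assumes "graded_assignment u"
  shows "mop_deg J D d \<Longrightarrow> z \<in> comp g \<Longrightarrow> mop_eval u D z \<in> comp (d + g)"
proof (induction rule: mop_deg.induct)
  case (2 x D d)
  have "u x \<in> comp (fst x)" using assms unfolding graded_assignment_def by blast
  with 2 show ?case using mult_comp[of "u x" "fst x" "mop_eval u D z" "d + g"] by (simp add: add.assoc)
next
  case (3 x D d)
  have "u x \<in> comp (fst x)" using assms unfolding graded_assignment_def by blast
  with 3 show ?case using mult_comp[of "mop_eval u D z" "d + g" "u x" "fst x"] by (simp add: ac_simps)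
qed (auto intro: subspace_add[OF subspace_comp] subspace_scale[OF subspace_comp] subspace_0[OF subspace_comp])

end

context fin_dim_graded_simple_algebra
begin

lemma exists_graded_basis: "\<exists>J u. graded_basis J u"
proof -
  obtain B0 where "finite_dimensional_vector_space scale B0" using finite_dim by blast
  then interpret fd: finite_dimensional_vector_space scale B0 .
  obtain B where B: "B \<subseteq> (\<Union>g. comp g)" "independent B" "(\<Union>g. comp g) \<subseteq> span B"
    using maximal_independent_subset by blast
  have fin: "finite B" using B(2) by (rule fd.finiteI_independent)
  have spB: "v \<in> span B" for v
  proof -
    have "(\<Sum>i | proj i v \<noteq> 0. proj i v) \<in> span B" using B(3) proj_all[of v] by (intro span_sum) auto
    then show ?thesis using proj_all[of v] by simp
  qed
  obtain n :: "'u \<Rightarrow> nat" where n: "inj_on n B" using fin finite_imp_inj_to_nat_seg by blast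
  obtain d where d: "\<And>b. b \<in> B \<Longrightarrow> b \<in> comp (d b)" using B(1) by (metis UN_iff subsetD)
  define e where "e b = (d b, n b)" for b
  have inj: "inj_on e B" using n by (auto simp: inj_on_def e_def)
  define J where "J = e ` B"
  define u where "u x = (if x \<in> J then inv_into B e x else 0)" for x
  have ue: "u (e b) = b" if "b \<in> B" for b using that inj by (simp add: u_def J_def)
  have sumJ: "(\<Sum>j\<in>J. scale (c j) (u j)) = (\<Sum>b\<in>B. scale (c (e b)) b)" for c
    unfolding J_def using inj by (simp add: sum.reindex ue)
  have "graded_basis J u"
    unfolding graded_basis_def
  proof (intro conjI allI impI)
    show "finite J" using fin by (simp add: J_def)
    show "graded_assignment u" unfolding graded_assignment_def
    proof
      fix x show "u x \<in> comp (fst x)"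
        using d ue subspace_0[OF subspace_comp] by (cases "x \<in> J") (auto simp: u_def J_def e_def)
    qed
  next
    fix w
    obtain c where "w = (\<Sum>b\<in>B. scale (c b) b)" using spB[of w] fin by (auto simp: span_finite)
    then have "w = (\<Sum>j\<in>J. scale (c (u j)) (u j))" unfolding sumJ by (simp add: ue)
    then show "\<exists>c. w = (\<Sum>j\<in>J. scale (c j) (u j))" by (rule exI[of _ "\<lambda>j. c (u j)"])
  next
    fix c assume "(\<Sum>j\<in>J. scale (c j) (u j)) = 0"
    then have "\<forall>b\<in>B. c (e b) = 0" unfolding sumJ using independentD[OF B(2) fin subset_refl, of "\<lambda>b. c (e b)"] by blast
    then show "\<forall>j\<in>J. c j = 0" by (auto simp: J_def)
  qed
  then show ?thesis by blast
qed

lemma nonzero_homogeneous_product: "\<exists>a b p q. p \<in> comp a \<and> q \<in> comp b \<and> mult p q \<noteq> 0"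
proof (rule ccontr)
  assume no: "\<not> ?thesis"
  have "mult x y = 0" for x y
  proof -
    have "mult x y = mult (\<Sum>i | proj i x \<noteq> 0. proj i x) (\<Sum>i | proj i y \<noteq> 0. proj i y)"
      using proj_all[of x] proj_all[of y] by simp
    also have "\<dots> = (\<Sum>i | proj i y \<noteq> 0. \<Sum>j | proj j x \<noteq> 0. mult (proj j x) (proj i y))"
      by (simp only: mult_simps)
    also have "\<dots> = 0" using no proj_all by (intro sum.neutral ballI) blast
    finally show ?thesis .
  qed
  then have "{mult x y | x y. True} = {0}" by auto
  then show False using simple by (simp add: graded_simple_def)
qed

text \<open>The images of \<open>a\<close> under the operators of all degrees span a homogeneous two-sided
  ideal, since every element of the algebra is a combination of the \<open>u j\<close>. It contains \<open>a\<close>, so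
  it is the whole algebra.\<close>

lemma mop_transitive:
  assumes b: "graded_basis J u" and a: "a \<in> comp g" "a \<noteq> 0" and w: "w \<in> comp h"
  shows "\<exists>D. mop_deg J D (h - g) \<and> mop_eval u D a = w"
proof -
  have ga: "graded_assignment u" using b by (simp add: graded_basis_def)
  define I where "I h = {mop_eval u D a | D. mop_deg J D (h - g)}" for h
  have I1: "subspace (I h)" for h
    unfolding subspace_def
  proof (intro conjI ballI allI)
    show "0 \<in> I h" unfolding I_def by (intro CollectI exI[of _ MZero]) (simp add: mop_deg.intros)
    show "x + y \<in> I h" if xy: "x \<in> I h" "y \<in> I h" for x y
    proof -
      obtain D E where "x = mop_eval u D a" "mop_deg J D (h - g)" "y = mop_eval u E a" "mop_deg J E (h - g)"
        using xy unfolding I_def by auto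
      then show ?thesis unfolding I_def by (intro CollectI exI[of _ "MAdd D E"]) (simp add: mop_deg.intros)
    qed
    show "scale c x \<in> I h" if x: "x \<in> I h" for c x
    proof -
      obtain D where "x = mop_eval u D a" "mop_deg J D (h - g)"
        using x unfolding I_def by auto
      then show ?thesis unfolding I_def by (intro CollectI exI[of _ "MScale c D"]) (simp add: mop_deg.intros)
    qed
  qed
  have I2: "I h \<subseteq> comp h" for h
    using mop_eval_comp_degree[OF ga _ a(1), of J _ "h - g"] by (auto simp: I_def)
  let ?W = "span (\<Union>h. I h)"
  have mj: "mult (u j) x \<in> I (fst j + h) \<and> mult x (u j) \<in> I (fst j + h)" if x: "x \<in> I h" and j: "j \<in> J" for x j h
  proof -
    obtain D where D: "x = mop_eval u D a" "mop_deg J D (h - g)" using x by (auto simp: I_def)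
    have "mop_deg J (MLeft j D) (fst j + h - g)" "mop_deg J (MRight j D) (fst j + h - g)"
      using mop_deg.intros(2,3)[OF j D(2)] by (simp_all add: algebra_simps)
    moreover have "mult (u j) x = mop_eval u (MLeft j D) a" "mult x (u j) = mop_eval u (MRight j D) a"
      by (simp_all add: D(1))
    ultimately show ?thesis unfolding I_def by blast
  qed
  have ideal: "two_sided_ideal ?W"
    unfolding two_sided_ideal_def
  proof (intro conjI ballI)
    show "subspace ?W" by (rule subspace_span)
    fix v assume "v \<in> ?W"
    then show "\<forall>x. mult x v \<in> ?W \<and> mult v x \<in> ?W"
    proof (induction rule: span_induct)
      case base
      show ?case by (auto simp: subspace_def mult_simps intro: span_add span_scale span_zero)
    next
      case (step v)
      then obtain h where h: "v \<in> I h" by blast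
      show ?case
      proof (intro allI conjI)
        fix x
        have "mult x v = (\<Sum>j\<in>J. scale (crd J u x j) (mult (u j) v))"
          by (subst crd_sum[OF b, of x]) (simp add: mult_simps)
        also have "\<dots> \<in> ?W" using mj[OF h] by (intro span_sum span_scale span_base) blast
        finally show "mult x v \<in> ?W" .
        have "mult v x = (\<Sum>j\<in>J. scale (crd J u x j) (mult v (u j)))"
          by (subst crd_sum[OF b, of x]) (simp add: mult_simps)
        also have "\<dots> \<in> ?W" using mj[OF h] by (intro span_sum span_scale span_base) blast
        finally show "mult v x \<in> ?W" .
      qed
    qed
  qed
  have "a \<in> I g" unfolding I_def by (intro CollectI exI[of _ MId]) (simp add: mop_deg.intros)
  then have "a \<in> ?W" by (intro span_base) blast
  then have "?W \<noteq> {0}" using a(2) by blast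
  then have "?W = UNIV"
    using simple ideal span_of_graded_pieces(2)[OF I1 I2] unfolding graded_simple_def by blast
  then have "proj h w \<in> I h" using span_of_graded_pieces(1)[OF I1 I2] by blast
  then show ?thesis using proj_comp[OF w] by (auto simp: I_def)
qed

end

text \<open>The algebras of the theorem. That the field is algebraically closed is used for
  Schur's lemma in the density theorem and for the extension of homomorphisms.\<close>

locale closed_graded_simple_algebra = fin_dim_graded_simple_algebra scale mult comp
  for scale :: "'f::alg_closed_field \<Rightarrow> 'u::ab_group_add \<Rightarrow> 'u"
    and mult :: "'u \<Rightarrow> 'u \<Rightarrow> 'u"
    and comp :: "'g::ab_group_add \<Rightarrow> 'u set"
begin

text \<open>The graded form of Jacobson's density theorem. The induction step has to separate \<open>a\<close>
  from one further vector \<open>s\<close> by an operator that kills \<open>S\<close> already; transitivity then moves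
  the image of \<open>a\<close> to \<open>w\<close>. Operators of degree \<open>0\<close> suffice for the separation.\<close>

lemma mop_density:
  assumes b: "graded_basis J u" and "finite S" and "S \<subseteq> comp g"
    and "a \<in> comp g" "a \<notin> span S" and "w \<in> comp h"
  shows "\<exists>D. mop_deg J D (h - g) \<and> mop_eval u D a = w \<and> (\<forall>s\<in>S. mop_eval u D s = 0)"
  using assms(2-)
proof (induction S arbitrary: a w h rule: finite_induct)
  case empty
  then have "a \<noteq> 0" by auto
  then show ?case using mop_transitive[OF b] empty by auto
next
  case (insert s S)
  have ga: "graded_assignment u" by (rule graded_basisD[OF b])
  have sS: "s \<in> comp g" "S \<subseteq> comp g" using insert.prems by auto
  have aS: "a \<notin> span S" using insert.prems(3) span_mono[of S "insert s S"] by auto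
  show ?case
  proof (cases "s \<in> span S")
    case True
    obtain D where D: "mop_deg J D (h - g)" "mop_eval u D a = w" "\<forall>x\<in>S. mop_eval u D x = 0"
      using insert.IH[OF sS(2) insert.prems(2) aS insert.prems(4)] by blast
    have "mop_eval u D s = 0" by (rule mop.eq_0_on_span[OF _ True]) (use D in blast)
    then show ?thesis using D by blast
  next
    case False
    define A where "A D \<longleftrightarrow> mop_deg J D 0 \<and> (\<forall>x\<in>S. mop_eval u D x = 0)" for D
    have Acomb: "A (MAdd D (MScale c E))" if "A D" "A E" for D E c
      using that by (auto simp: A_def intro: mop_deg.intros)
    have Acomp: "A (mop_comp E D)" if "mop_deg J E 0" "A D" for D E
      using that mop_deg_comp[of J E 0 D 0] by (auto simp: A_def mop_eval_comp mop.zero)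
    have Adeg: "mop_eval u D x \<in> comp g" if "A D" "x \<in> comp g" for D x
      using mop_eval_comp_degree[OF ga, of J D 0 x g] that by (simp add: A_def)
    have Aex: "\<exists>D. A D \<and> mop_eval u D y = x" if "y \<in> comp g" "y \<notin> span S" "x \<in> comp g" for x y
      using insert.IH[OF sS(2) that] by (simp add: A_def) blast
    (* If no such operator exists, D s |-> D a is a well-defined linear map on the component of
       degree g. It commutes with all multiplications, so it is a scalar r by Schur's lemma, and
       all the operators in A kill a - r s: this contradicts the induction hypothesis. *)
    have "\<exists>D. A D \<and> mop_eval u D s = 0 \<and> mop_eval u D a \<noteq> 0"
    proof (rule ccontr)
      assume "\<not> ?thesis"
      then have kill: "mop_eval u D a = 0" if "A D" "mop_eval u D s = 0" for D using that by blast
      define \<theta> where "\<theta> x = mop_eval u (SOME D. A D \<and> mop_eval u D s = x) a" for x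
      have \<theta>: "\<theta> (mop_eval u D s) = mop_eval u D a" if D: "A D" for D
      proof -
        define E where "E = (SOME E. A E \<and> mop_eval u E s = mop_eval u D s)"
        have E: "A E \<and> mop_eval u E s = mop_eval u D s"
          unfolding E_def by (rule someI[of _ D]) (use D in simp)
        have "mop_eval u (MAdd D (MScale (-1) E)) a = 0"
          using E D by (intro kill Acomb) simp_all
        then show ?thesis by (simp add: \<theta>_def E_def[symmetric])
      qed
      obtain B0 where B0: "finite_dimensional_vector_space scale B0" using finite_dim by blast
      have "s \<noteq> 0" using False span_zero by blast
      have "\<exists>r x. x \<in> comp g \<and> x \<noteq> 0 \<and> \<theta> x = scale r x"
      proof (rule eigenvector_exists[OF B0 subspace_comp _ _ _ sS(1) \<open>s \<noteq> 0\<close>])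
        fix x assume x: "x \<in> comp g"
        obtain D where D: "A D" "mop_eval u D s = x" using Aex[OF sS(1) False x] by blast
        show "\<theta> x \<in> comp g" using \<theta>[OF D(1)] D Adeg[OF D(1) insert.prems(2)] by simp
        have "A (MAdd MZero (MScale c D))" for c
          by (rule Acomb[OF _ D(1)]) (simp add: A_def mop_deg.intros)
        from \<theta>[OF this] show "\<theta> (scale c x) = scale c (\<theta> x)" for c using \<theta>[OF D(1)] D by simp
        fix y assume y: "y \<in> comp g"
        obtain E where E: "A E" "mop_eval u E s = y" using Aex[OF sS(1) False y] by blast
        show "\<theta> (x + y) = \<theta> x + \<theta> y"
          using \<theta>[OF Acomb[OF D(1) E(1), of 1]] \<theta>[OF D(1)] \<theta>[OF E(1)] D E by simp
      qed
      then obtain r x where x: "x \<in> comp g" "x \<noteq> 0" "\<theta> x = scale r x" by blast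
      obtain D1 where D1: "A D1" "mop_eval u D1 s = x" using Aex[OF sS(1) False x(1)] by blast
      then have D1a: "mop_eval u D1 a = scale r x" using \<theta>[OF D1(1)] x by simp
      define a' where "a' = a - scale r s"
      have a': "a' \<in> comp g" unfolding a'_def
        by (intro subspace_diff[OF subspace_comp] subspace_scale[OF subspace_comp] insert.prems(2) sS)
      have a'S: "a' \<notin> span S"
        using insert.prems(3) unfolding a'_def span_breakdown_eq[of a s S] by blast
      obtain D where D: "A D" "mop_eval u D a' = a'" using Aex[OF a' a'S a'] by blast
      obtain E where E: "mop_deg J E 0" "mop_eval u E x = mop_eval u D s"
        using mop_transitive[OF b x(1,2) Adeg[OF D(1) sS(1)]] by auto
      have "mop_eval u (MAdd D (MScale (-1) (mop_comp E D1))) a = 0"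
        using D(1) D1 E by (intro kill Acomb Acomp) (simp_all add: mop_eval_comp)
      then have "mop_eval u D a = scale r (mop_eval u D s)"
        by (simp add: mop_eval_comp D1a mop.scale E)
      then have "a' = 0" using D(2) unfolding a'_def by (simp add: mop.diff mop.scale)
      then show False using a'S span_zero by simp
    qed
    then obtain D where D: "A D" "mop_eval u D s = 0" "mop_eval u D a \<noteq> 0" by blast
    obtain E where E: "mop_deg J E (h - g)" "mop_eval u E (mop_eval u D a) = w"
      using mop_transitive[OF b Adeg[OF D(1) insert.prems(2)] D(3) insert.prems(4)] by blast
    have "mop_deg J (mop_comp E D) (h - g)" using mop_deg_comp[OF E(1), of D 0] D(1) by (simp add: A_def)
    then show ?thesis using D E
      by (intro exI[of _ "mop_comp E D"]) (auto simp: mop_eval_comp A_def mop.zero)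
  qed
qed

end

section \<open>Alternators\<close>

text \<open>An alternator is a list of entries \<open>(j, D, E)\<close>. For slots \<open>s\<close> and an argument \<open>z\<close> its
  term is \<open>D\<^sub>1(s j\<^sub>1) E\<^sub>1(D\<^sub>2(s j\<^sub>2) E\<^sub>2(\<dots> z))\<close>,
  where the operators are evaluated at an assignment of their own. When every element of \<open>J\<close>
  occurs once, the term is linear in each slot and in \<open>z\<close>. The signed sum over the
  permutations of \<open>J\<close> that preserve degrees is then alternating in the slots of each degree,
  like a determinant. Slots and operators are kept apart so that a slot can be replaced while
  the operators stay as they are.\<close>

type_synonym ('x, 'f) alternator = "('x \<times> ('x, 'f) mop \<times> ('x, 'f) mop) list"

definition deg_perms :: "('g \<times> 'n) set \<Rightarrow> ('g \<times> 'n \<Rightarrow> 'g \<times> 'n) set" where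
  "deg_perms J = {\<sigma>. \<sigma> permutes J \<and> (\<forall>j. fst (\<sigma> j) = fst j)}"

definition enumerates :: "'x set \<Rightarrow> ('x, 'f) alternator \<Rightarrow> bool" where
  "enumerates J al \<longleftrightarrow> distinct (map fst al) \<and> fst ` set al = J"

primrec term_poly :: "('x \<Rightarrow> 'x magma \<Rightarrow>\<^sub>0 'f::comm_ring_1) \<Rightarrow> ('x, 'f) alternator \<Rightarrow> ('x magma \<Rightarrow>\<^sub>0 'f) \<Rightarrow> ('x magma \<Rightarrow>\<^sub>0 'f)" where
  "term_poly S [] Z = Z"
| "term_poly S (b # al) Z = pmul (mop_poly (fst (snd b)) (S (fst b))) (mop_poly (snd (snd b)) (term_poly S al Z))"

definition alt_poly :: "('g \<times> 'n) set \<Rightarrow> ('g \<times> 'n, 'f::comm_ring_1) alternator \<Rightarrow> ('g \<times> 'n \<Rightarrow> ('g \<times> 'n) magma \<Rightarrow>\<^sub>0 'f)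
    \<Rightarrow> (('g \<times> 'n) magma \<Rightarrow>\<^sub>0 'f) \<Rightarrow> (('g \<times> 'n) magma \<Rightarrow>\<^sub>0 'f)" where
  "alt_poly J al S Z = (\<Sum>\<sigma>\<in>deg_perms J. pscale (of_int (sign \<sigma>)) (term_poly (S \<circ> \<sigma>) al Z))"

definition nest_poly :: "('g \<times> 'n) set \<Rightarrow> ('g \<times> 'n, 'f::comm_ring_1) alternator list
    \<Rightarrow> (('g \<times> 'n) magma \<Rightarrow>\<^sub>0 'f) \<Rightarrow> (('g \<times> 'n) magma \<Rightarrow>\<^sub>0 'f)" where
  "nest_poly J als Z = foldr (\<lambda>al. alt_poly J al pvar) als Z"

lemma finite_deg_perms: "finite J \<Longrightarrow> finite (deg_perms J)"
  by (rule finite_subset[OF _ finite_permutations[of J]]) (auto simp: deg_perms_def)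

context graded_algebra
begin

primrec term_eval :: "('g \<times> nat \<Rightarrow> 'u) \<Rightarrow> ('g \<times> nat \<Rightarrow> 'u) \<Rightarrow> ('g \<times> nat, 'f) alternator \<Rightarrow> 'u \<Rightarrow> 'u" where
  "term_eval u s [] z = z"
| "term_eval u s (b # al) z =
    mult (mop_eval u (fst (snd b)) (s (fst b))) (mop_eval u (snd (snd b)) (term_eval u s al z))"

definition alt_eval :: "('g \<times> nat) set \<Rightarrow> ('g \<times> nat \<Rightarrow> 'u) \<Rightarrow> ('g \<times> nat, 'f) alternator \<Rightarrow> ('g \<times> nat \<Rightarrow> 'u) \<Rightarrow> 'u \<Rightarrow> 'u" where
  "alt_eval J u al s z = (\<Sum>\<sigma>\<in>deg_perms J. scale (of_int (sign \<sigma>)) (term_eval u (s \<circ> \<sigma>) al z))"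

definition nest_eval :: "('g \<times> nat) set \<Rightarrow> ('g \<times> nat \<Rightarrow> 'u) \<Rightarrow> ('g \<times> nat, 'f) alternator list \<Rightarrow> 'u \<Rightarrow> 'u" where
  "nest_eval J u als z = foldr (\<lambda>al. alt_eval J u al u) als z"

lemma eval_term_poly: "eval_poly u (term_poly S al Z) = term_eval u (\<lambda>x. eval_poly u (S x)) al (eval_poly u Z)"
  by (induction al) (simp_all add: eval_poly_pmul eval_mop_poly)

lemma eval_alt_poly: "eval_poly u (alt_poly J al S Z) = alt_eval J u al (\<lambda>x. eval_poly u (S x)) (eval_poly u Z)"
  by (simp add: alt_poly_def alt_eval_def eval_poly_sum eval_poly_pscale eval_term_poly comp_def)

lemma eval_alt_poly_pvar: "eval_poly u (alt_poly J al pvar Z) = alt_eval J u al u (eval_poly u Z)"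
  by (simp add: eval_alt_poly eval_poly_pvar)

lemma eval_nest_poly: "eval_poly u (nest_poly J als Z) = nest_eval J u als (eval_poly u Z)"
  by (induction als) (simp_all add: nest_poly_def nest_eval_def eval_alt_poly_pvar)

lemma term_eval_arg_linear:
  "term_eval u s al (y + z) = term_eval u s al y + term_eval u s al z"
  "term_eval u s al (scale c z) = scale c (term_eval u s al z)"
  by (induction al) (simp_all add: mop.add mop.scale mult_simps)

lemma alt_eval_arg_scale: "alt_eval J u al s (scale c z) = scale c (alt_eval J u al s z)"
  by (simp add: alt_eval_def term_eval_arg_linear scale_sum_right mult.commute)

lemma alt_eval_arg_0: "alt_eval J u al s 0 = 0"
  using alt_eval_arg_scale[of J u al s 0 0] by simp

lemma nest_eval_scale: "nest_eval J u als (scale c z) = scale c (nest_eval J u als z)"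
  by (induction als) (simp_all add: nest_eval_def alt_eval_arg_scale)

lemma nest_eval_append: "nest_eval J u (als @ bls) z = nest_eval J u als (nest_eval J u bls z)"
  by (simp add: nest_eval_def)

lemma term_eval_unused:
  "j \<notin> fst ` set al \<Longrightarrow> term_eval u (s(j := w)) al z = term_eval u s al z"
  by (induction al) auto

lemma term_eval_slot_linear:
  assumes "distinct (map fst al)" "j \<in> fst ` set al"
  shows "term_eval u (s(j := w + w')) al z = term_eval u (s(j := w)) al z + term_eval u (s(j := w')) al z"
    and "term_eval u (s(j := scale c w)) al z = scale c (term_eval u (s(j := w)) al z)"
proof -
  have "term_eval u (s(j := w + w')) al z = term_eval u (s(j := w)) al z + term_eval u (s(j := w')) al z
    \<and> term_eval u (s(j := scale c w)) al z = scale c (term_eval u (s(j := w)) al z)"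
    using assms
  proof (induction al)
    case (Cons b al)
    show ?case
    proof (cases "fst b = j")
      case True
      then have "j \<notin> fst ` set al" using Cons.prems by auto
      then show ?thesis using True
        by (simp add: term_eval_unused mop.add mop.scale mult_simps fun_upd_same del: fun_upd_apply)
    next
      case False
      then show ?thesis using Cons by (auto simp: mop.add mop.scale mult_simps)
    qed
  qed simp
  then show "term_eval u (s(j := w + w')) al z = term_eval u (s(j := w)) al z + term_eval u (s(j := w')) al z"
    and "term_eval u (s(j := scale c w)) al z = scale c (term_eval u (s(j := w)) al z)" by auto
qed

lemma term_eval_zero:
  assumes "b \<in> set al" "mop_eval u (fst (snd b)) (s (fst b)) = 0"
  shows "term_eval u s al z = 0"
  using assms by (induction al) (auto simp: mult_simps mop.zero)

lemma upd_comp_perm: "\<sigma> permutes J \<Longrightarrow> s(k := w) \<circ> \<sigma> = (s \<circ> \<sigma>)(inv \<sigma> k := w)"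
  by (rule ext) (metis comp_apply fun_upd_apply permutes_inv_eq)

lemma alt_eval_slot_linear:
  assumes "enumerates J al" "k \<in> J"
  shows "alt_eval J u al (s(k := w + w')) z = alt_eval J u al (s(k := w)) z + alt_eval J u al (s(k := w')) z"
    and "alt_eval J u al (s(k := scale c w)) z = scale c (alt_eval J u al (s(k := w)) z)"
proof -
  have d: "distinct (map fst al)" using assms by (simp add: enumerates_def)
  have k: "\<sigma> permutes J" "inv \<sigma> k \<in> fst ` set al" if "\<sigma> \<in> deg_perms J" for \<sigma>
    using that assms permutes_in_image[OF permutes_inv, of \<sigma> J k] by (auto simp: deg_perms_def enumerates_def)
  show "alt_eval J u al (s(k := w + w')) z = alt_eval J u al (s(k := w)) z + alt_eval J u al (s(k := w')) z"
    unfolding alt_eval_def sum.distrib[symmetric]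
    by (intro sum.cong refl) (simp add: upd_comp_perm[OF k(1)] term_eval_slot_linear(1)[OF d k(2)] scale_right_distrib)
  show "alt_eval J u al (s(k := scale c w)) z = scale c (alt_eval J u al (s(k := w)) z)"
    unfolding alt_eval_def scale_sum_right
    by (intro sum.cong refl) (simp add: upd_comp_perm[OF k(1)] term_eval_slot_linear(2)[OF d k(2)] mult.commute)
qed

lemma alt_eval_slot_0:
  assumes "enumerates J al" "k \<in> J"
  shows "alt_eval J u al (s(k := 0)) z = 0"
  using alt_eval_slot_linear(2)[OF assms, of u s 0 0 z] by simp

lemma alt_eval_slot_sum:
  assumes "enumerates J al" "k \<in> J"
  shows "alt_eval J u al (s(k := (\<Sum>i\<in>I. scale (c i) (w i)))) z = (\<Sum>i\<in>I. scale (c i) (alt_eval J u al (s(k := w i)) z))"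
  by (induction I rule: infinite_finite_induct)
    (simp_all add: alt_eval_slot_0[OF assms] alt_eval_slot_linear[OF assms] del: fun_upd_apply)

text \<open>Composition with the transposition of \<open>a\<close> and \<open>b\<close> matches even with odd permutations
  and does not change the terms. The two halves of the sum cancel in every characteristic,
  including \<open>2\<close>.\<close>

lemma alt_eval_repeated:
  assumes J: "finite J" and ab: "a \<in> J" "b \<in> J" "a \<noteq> b" "fst a = fst b" "s a = s b"
  shows "alt_eval J u al s z = 0"
proof -
  define \<tau> where "\<tau> = transpose a b"
  have \<tau>: "\<tau> permutes J" unfolding \<tau>_def by (rule permutes_swap_id) (use ab in auto)
  have \<tau>P: "\<tau> \<circ> \<sigma> \<in> deg_perms J" if "\<sigma> \<in> deg_perms J" for \<sigma>
    using that permutes_compose[OF _ \<tau>, of \<sigma>] ab by (auto simp: deg_perms_def \<tau>_def transpose_def)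
  have ev: "evenperm (\<tau> \<circ> \<sigma>) \<longleftrightarrow> \<not> evenperm \<sigma>" if "\<sigma> \<in> deg_perms J" for \<sigma>
    using that permutes_imp_permutation[OF J] ab(3) \<tau>
    by (subst evenperm_comp) (auto simp: deg_perms_def \<tau>_def evenperm_swap)
  have inv: "\<tau> \<circ> (\<tau> \<circ> \<sigma>) = \<sigma>" for \<sigma> :: "'g \<times> nat \<Rightarrow> 'g \<times> nat" by (simp add: fun_eq_iff \<tau>_def)
  have s\<tau>: "s \<circ> (\<tau> \<circ> \<sigma>) = s \<circ> \<sigma>" for \<sigma> :: "'g \<times> nat \<Rightarrow> 'g \<times> nat"
    using ab(5) by (auto simp: fun_eq_iff \<tau>_def transpose_def)
  let ?t = "\<lambda>\<sigma>. term_eval u (s \<circ> \<sigma>) al z"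
  let ?E = "deg_perms J \<inter> {\<sigma>. evenperm \<sigma>}" and ?O = "deg_perms J \<inter> - {\<sigma>. evenperm \<sigma>}"
  have fin: "finite (deg_perms J)" by (rule finite_deg_perms[OF J])
  have "(\<Sum>\<sigma>\<in>?E. ?t \<sigma>) = (\<Sum>\<sigma>\<in>?O. ?t \<sigma>)"
    by (rule sum.reindex_bij_witness[of _ "\<lambda>\<sigma>. \<tau> \<circ> \<sigma>" "\<lambda>\<sigma>. \<tau> \<circ> \<sigma>"])
      (auto simp: inv \<tau>P ev s\<tau>)
  moreover have "alt_eval J u al s z = (\<Sum>\<sigma>\<in>deg_perms J. if evenperm \<sigma> then ?t \<sigma> else - ?t \<sigma>)"
    unfolding alt_eval_def by (intro sum.cong) (auto simp: sign_def)
  then have "alt_eval J u al s z = (\<Sum>\<sigma>\<in>?E. ?t \<sigma>) + (\<Sum>\<sigma>\<in>?O. - ?t \<sigma>)"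
    unfolding sum.If_cases[OF fin] .
  ultimately show ?thesis by (simp add: sum_negf)
qed

text \<open>This is how alternators see coefficients: a slot filled with a combination of the
  slots of its degree multiplies the value with the coefficient that belongs to the slot, as
  in Cramer's rule.\<close>

lemma alt_eval_combination:
  assumes J: "finite J" and en: "enumerates J al" and k: "k \<in> J"
  shows "alt_eval J u al (s(k := (\<Sum>l | l \<in> J \<and> fst l = fst k. scale (c l) (s l)))) z = scale (c k) (alt_eval J u al s z)"
proof -
  have "alt_eval J u al (s(k := s l)) z = 0" if "l \<in> J" "fst l = fst k" "l \<noteq> k" for l
    by (rule alt_eval_repeated[OF J that(1) k]) (use that in auto)
  then show ?thesis
    unfolding alt_eval_slot_sum[OF en k]
    using J k by (subst sum.remove[of _ k]) (auto intro!: sum.neutral)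
qed

text \<open>A linear relation puts \<open>0\<close> into the slot \<open>k\<close>, which multiplies the value with \<open>c k\<close>.
  The relation may be taken homogeneous, after projection to the degree of \<open>k\<close>.\<close>

lemma alt_eval_nonzero_imp_independent:
  assumes J: "finite J" and en: "enumerates J al" and s: "graded_assignment s"
    and nz: "alt_eval J u al s z \<noteq> 0" and rel: "(\<Sum>j\<in>J. scale (c j) (s j)) = 0" and k: "k \<in> J"
  shows "c k = 0"
proof -
  have deg: "s j \<in> comp (fst j)" for j using s unfolding graded_assignment_def by blast
  have "0 = proj (fst k) (\<Sum>j\<in>J. scale (c j) (s j))" by (simp add: rel pr.zero)
  also have "\<dots> = (\<Sum>j\<in>J. if fst j = fst k then scale (c j) (s j) else 0)"
    unfolding pr.sum pr.scale by (intro sum.cong) (auto simp: proj_comp[OF deg])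
  also have "\<dots> = (\<Sum>l | l \<in> J \<and> fst l = fst k. scale (c l) (s l))"
    using J by (simp add: sum.inter_filter)
  finally have "alt_eval J u al (s(k := 0)) z = scale (c k) (alt_eval J u al s z)"
    using alt_eval_combination[OF J en k, of u s c z] by simp
  then show ?thesis using nz by (simp add: alt_eval_slot_0[OF en k])
qed

end

context fin_dim_graded_simple_algebra
begin

lemma graded_basis_nonempty: "graded_basis J u \<Longrightarrow> \<exists>j\<in>J. u j \<noteq> 0"
proof (rule ccontr)
  assume b: "graded_basis J u" and "\<not> (\<exists>j\<in>J. u j \<noteq> 0)"
  then have "w = 0" for w :: 'u using crd_sum[OF b, of w] by simp
  then show False using nonzero_homogeneous_product by blast
qed

lemma family_card_le_dim:
  fixes u :: "'x \<Rightarrow> 'u" and w :: 'u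
  assumes J: "finite J" and ind: "\<And>c j. (\<Sum>j\<in>J. scale (c j) (u j)) = 0 \<Longrightarrow> j \<in> J \<Longrightarrow> c j = 0"
  shows "card J \<le> dim (UNIV :: 'u set)"
    and "card J = dim (UNIV :: 'u set) \<Longrightarrow> \<exists>c. w = (\<Sum>j\<in>J. scale (c j) (u j))"
proof -
  obtain B0 where "finite_dimensional_vector_space scale B0" using finite_dim by blast
  then interpret fd: finite_dimensional_vector_space scale B0 .
  have inj: "inj_on u J"
  proof (rule inj_onI)
    fix i j assume ij: "i \<in> J" "j \<in> J" "u i = u j"
    show "i = j"
    proof (rule ccontr)
      assume ne: "i \<noteq> j"
      have "(\<Sum>l\<in>J. scale (if l = i then 1 else if l = j then -1 else 0) (u l)) = (\<Sum>l\<in>{i, j}. scale (if l = i then 1 else if l = j then -1 else 0) (u l))"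
        using ij J by (intro sum.mono_neutral_right) auto
      also have "\<dots> = 0" using ne ij(3) by simp
      finally show False using ind[of "\<lambda>l. if l = i then 1 else if l = j then -1 else 0" i] ij by simp
    qed
  qed
  have indep: "independent (u ` J)"
  proof (rule independent_if_scalars_zero)
    fix f x assume f: "(\<Sum>x\<in>u ` J. scale (f x) x) = 0" and x: "x \<in> u ` J"
    have "(\<Sum>j\<in>J. scale (f (u j)) (u j)) = 0" using f by (simp add: sum.reindex[OF inj])
    from ind[OF this] x show "f x = 0" by auto
  qed (use J in simp)
  have c: "card (u ` J) = card J" by (rule card_image[OF inj])
  show "card J \<le> dim (UNIV :: 'u set)"
    using fd.independent_card_le_dim[OF subset_UNIV indep] unfolding c .
  assume "card J = dim (UNIV :: 'u set)"
  then have "UNIV \<subseteq> span (u ` J)"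
    by (intro fd.card_ge_dim_independent[OF subset_UNIV indep]) (simp add: c)
  then have "w \<in> span (u ` J)" by blast
  then obtain f where "w = (\<Sum>x\<in>u ` J. scale (f x) x)" using J by (auto simp: span_finite)
  then have "w = (\<Sum>j\<in>J. scale (f (u j)) (u j))" by (simp add: sum.reindex[OF inj])
  then show "\<exists>c. w = (\<Sum>j\<in>J. scale (c j) (u j))" by (rule exI[of _ "\<lambda>j. f (u j)"])
qed

lemma graded_basis_card:
  assumes b: "graded_basis J u"
  shows "card J = dim (UNIV :: 'u set)"
proof (rule antisym)
  show "card J \<le> dim (UNIV :: 'u set)"
    by (rule family_card_le_dim(1)[of J u, OF graded_basisD(1)[OF b]]) (rule graded_basisD(5)[OF b])
  obtain B0 where "finite_dimensional_vector_space scale B0" using finite_dim by blast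
  then interpret fd: finite_dimensional_vector_space scale B0 .
  have "w \<in> span (u ` J)" for w
    by (subst crd_sum[OF b, of w]) (intro span_sum span_scale span_base, blast)
  then have "dim (UNIV :: 'u set) \<le> card (u ` J)"
    using graded_basisD(1)[OF b] by (intro dim_le_card) auto
  also have "\<dots> \<le> card J" by (rule card_image_le[OF graded_basisD(1)[OF b]])
  finally show "dim (UNIV :: 'u set) \<le> card J" .
qed

lemma alt_eval_nonzero_imp_basis:
  assumes J: "finite J" and en: "enumerates J al" and s: "graded_assignment s"
    and nz: "alt_eval J u al s z \<noteq> 0"
  shows "card J \<le> dim (UNIV :: 'u set)" and "card J = dim (UNIV :: 'u set) \<Longrightarrow> graded_basis J s"
proof -
  note ind = alt_eval_nonzero_imp_independent[OF assms]
  show "card J \<le> dim (UNIV :: 'u set)" by (rule family_card_le_dim(1)[of J s, OF J]) (rule ind)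
  assume c: "card J = dim (UNIV :: 'u set)"
  have "\<exists>c. w = (\<Sum>j\<in>J. scale (c j) (s j))" for w
    by (rule family_card_le_dim(2)[of J s, OF J _ c]) (rule ind)
  then show "graded_basis J s"
    using J s ind unfolding graded_basis_def by blast
qed

end

context closed_graded_simple_algebra
begin

text \<open>Take homogeneous \<open>p\<close>, \<open>q\<close> with \<open>p q \<noteq> 0\<close>. By density \<open>D\<^sub>j\<close> can be chosen
  to send \<open>u j\<close> to \<open>p\<close> and to kill the other basis elements of the same degree, and
  \<open>E\<^sub>j\<close> to send the value of the remaining entries to \<open>q\<close>. So every nonempty list of
  entries has the value \<open>p q\<close>.\<close>

lemma exists_alternating_term:
  assumes b: "graded_basis J u" and z: "z \<in> comp d" "z \<noteq> 0" and js: "distinct js" "set js \<subseteq> J"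
  shows "\<exists>al d'. map fst al = js \<and> term_eval u u al z \<noteq> 0 \<and> term_eval u u al z \<in> comp d'
    \<and> (\<forall>x\<in>set al. \<forall>i\<in>J. i \<noteq> fst x \<longrightarrow> fst i = fst (fst x) \<longrightarrow> mop_eval u (fst (snd x)) (u i) = 0)"
  using js
proof (induction js)
  case Nil
  then show ?case using z by (intro exI[of _ "[]"]) auto
next
  case (Cons j js)
  then obtain al d' where al: "map fst al = js" "term_eval u u al z \<noteq> 0" "term_eval u u al z \<in> comp d'"
    "\<forall>x\<in>set al. \<forall>i\<in>J. i \<noteq> fst x \<longrightarrow> fst i = fst (fst x) \<longrightarrow> mop_eval u (fst (snd x)) (u i) = 0" by auto
  obtain a b' p q where pq: "p \<in> comp a" "q \<in> comp b'" "mult p q \<noteq> 0" using nonzero_homogeneous_product by blast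
  have j: "j \<in> J" using Cons.prems by auto
  define S where "S = u ` {i \<in> J. i \<noteq> j \<and> fst i = fst j}"
  have "crd J u x j = 0" if "x \<in> span S" for x
    using that
  proof (induction rule: span_induct)
    case base
    show ?case using crd_0[OF b j] crd_add[OF b j] crd_scale[OF b j] by (auto simp: subspace_def)
  next
    case (step x)
    then show ?case using crd_basis[OF b j] by (auto simp: S_def)
  qed
  moreover have "crd J u (u j) j = 1" using crd_basis[OF b j j] by simp
  ultimately have notin: "u j \<notin> span S" by fastforce
  have "finite S" "S \<subseteq> comp (fst j)" using graded_basisD[OF b] by (force simp: S_def)+
  from mop_density[OF b this graded_basisD(3)[OF b] notin pq(1)]
  obtain D where D: "mop_eval u D (u j) = p" "\<forall>s\<in>S. mop_eval u D s = 0" by blast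
  obtain E where E: "mop_eval u E (term_eval u u al z) = q" using mop_transitive[OF b al(3,2) pq(2)] by blast
  have "term_eval u u ((j, D, E) # al) z = mult p q" by (simp add: D E)
  then show ?case using al D(2) pq mult_comp[OF pq(1,2)]
    by (intro exI[of _ "(j, D, E) # al"] exI[of _ "a + b'"]) (auto simp: S_def)
qed

text \<open>With the operators of the preceding lemma only the identity permutation contributes to
  the sum.\<close>

lemma exists_alternator:
  assumes b: "graded_basis J u" and z: "z \<in> comp d" "z \<noteq> 0"
  shows "\<exists>al d'. enumerates J al \<and> alt_eval J u al u z \<noteq> 0 \<and> alt_eval J u al u z \<in> comp d'"
proof -
  obtain js where js: "set js = J" "distinct js" using finite_distinct_list[OF graded_basisD(1)[OF b]] by blast
  then obtain al d' where al: "map fst al = js" "term_eval u u al z \<noteq> 0" "term_eval u u al z \<in> comp d'"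
    "\<forall>x\<in>set al. \<forall>i\<in>J. i \<noteq> fst x \<longrightarrow> fst i = fst (fst x) \<longrightarrow> mop_eval u (fst (snd x)) (u i) = 0"
    using exists_alternating_term[OF b z, of js] by auto
  have en: "enumerates J al" using al(1) js by (auto simp: enumerates_def simp flip: set_map)
  (* a permutation other than the identity puts some basis element into a slot that kills it *)
  have zero: "term_eval u (u \<circ> \<sigma>) al z = 0" if \<sigma>: "\<sigma> \<in> deg_perms J" "\<sigma> \<noteq> id" for \<sigma>
  proof -
    obtain j where j: "\<sigma> j \<noteq> j" using \<sigma>(2) by (auto simp: fun_eq_iff)
    moreover have "fst (\<sigma> j) = fst j" using \<sigma>(1) unfolding deg_perms_def by blast
    moreover have "j \<in> J" "\<sigma> j \<in> J" using j
      using \<sigma>(1) permutes_not_in[of \<sigma> J j] permutes_in_image[of \<sigma> J j] by (auto simp: deg_perms_def)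
    moreover from \<open>j \<in> J\<close> obtain x where "x \<in> set al" "fst x = j" using en by (auto simp: enumerates_def)
    ultimately show ?thesis using al(4) j by (intro term_eval_zero[of x]) auto
  qed
  have "alt_eval J u al u z = (\<Sum>\<sigma>\<in>{id}. scale (of_int (sign \<sigma>)) (term_eval u (u \<circ> \<sigma>) al z))"
    unfolding alt_eval_def using zero finite_deg_perms[OF graded_basisD(1)[OF b]]
    by (intro sum.mono_neutral_right) (auto simp: deg_perms_def permutes_id)
  then have "alt_eval J u al u z = term_eval u u al z" by simp
  then show ?thesis using en al(2,3) by (intro exI[of _ al] exI[of _ d']) simp
qed

lemma exists_alternator_list:
  assumes b: "graded_basis J u" and z: "z \<in> comp d" "z \<noteq> 0"
  shows "\<exists>als. length als = n \<and> (\<forall>al\<in>set als. enumerates J al) \<and> nest_eval J u als z \<noteq> 0"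
proof -
  have "\<exists>als d'. length als = n \<and> (\<forall>al\<in>set als. enumerates J al) \<and> nest_eval J u als z \<noteq> 0 \<and> nest_eval J u als z \<in> comp d'"
  proof (induction n)
    case 0
    then show ?case using z by (auto simp: nest_eval_def)
  next
    case (Suc n)
    then obtain als d' where als: "length als = n" "\<forall>al\<in>set als. enumerates J al" "nest_eval J u als z \<noteq> 0"
      "nest_eval J u als z \<in> comp d'" by blast
    obtain al d'' where "enumerates J al" "alt_eval J u al u (nest_eval J u als z) \<noteq> 0"
      "alt_eval J u al u (nest_eval J u als z) \<in> comp d''"
      using exists_alternator[OF b als(4,3)] by blast
    then show ?case using als by (intro exI[of _ "al # als"] exI[of _ d'']) (simp add: nest_eval_def)
  qed
  then show ?thesis by blast
qed

end

section \<open>Polynomial relations between structure constants\<close>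

text \<open>Polynomial expressions in structure constants. The value of an alternator lies in the
  algebra, so a relation between scalars can be read off only after it has been multiplied
  with such values; a product of structure constants needs one alternator for each factor,
  which \<open>pexp_degree\<close> counts.\<close>

datatype ('t, 'f) pexp = PConst 'f | PVar 't | PAdd "('t, 'f) pexp" "('t, 'f) pexp" | PMul "('t, 'f) pexp" "('t, 'f) pexp"

primrec pexp_eval :: "('t \<Rightarrow> 'f::comm_ring_1) \<Rightarrow> ('t, 'f) pexp \<Rightarrow> 'f" where
  "pexp_eval c (PConst a) = a"
| "pexp_eval c (PVar t) = c t"
| "pexp_eval c (PAdd P Q) = pexp_eval c P + pexp_eval c Q"
| "pexp_eval c (PMul P Q) = pexp_eval c P * pexp_eval c Q"

primrec pexp_degree :: "('t, 'f) pexp \<Rightarrow> nat" where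
  "pexp_degree (PConst a) = 0"
| "pexp_degree (PVar t) = 1"
| "pexp_degree (PAdd P Q) = max (pexp_degree P) (pexp_degree Q)"
| "pexp_degree (PMul P Q) = pexp_degree P + pexp_degree Q"

text \<open>The triples \<open>(i, j, k)\<close> for which the product of the basis elements \<open>i\<close> and \<open>j\<close> has
  the degree of \<open>k\<close>. For other triples the structure constant is \<open>0\<close>, and \<open>u i * u j\<close> would
  not have the degree required by the slot \<open>k\<close>.\<close>

definition admissible :: "('g::ab_group_add \<times> 'n) set \<Rightarrow> ('g \<times> 'n) \<times> ('g \<times> 'n) \<times> ('g \<times> 'n) \<Rightarrow> bool" where
  "admissible J t \<longleftrightarrow> fst t \<in> J \<and> fst (snd t) \<in> J \<and> snd (snd t) \<in> J
     \<and> fst (snd (snd t)) = fst (fst t) + fst (fst (snd t))"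

text \<open>A polynomial that takes the value \<open>P(c) N\<close> at each basis with structure constants \<open>c\<close>,
  where \<open>N\<close> is the value of the nested alternators \<open>als\<close>: a factor \<open>c\<^sub>i\<^sub>j\<^sub>k\<close>
  arises when the slot \<open>k\<close> of one alternator is filled with \<open>x\<^sub>i x\<^sub>j\<close> instead of
  \<open>x\<^sub>k\<close>. The construction mentions no algebra, so the same polynomial serves \<open>U\<close> and
  \<open>V\<close>.\<close>

primrec realize :: "('g::ab_group_add \<times> 'n) set \<Rightarrow> (('g \<times> 'n) \<times> ('g \<times> 'n) \<times> ('g \<times> 'n), 'f::comm_ring_1) pexp
    \<Rightarrow> ('g \<times> 'n, 'f) alternator list \<Rightarrow> (('g \<times> 'n) magma \<Rightarrow>\<^sub>0 'f) \<Rightarrow> (('g \<times> 'n) magma \<Rightarrow>\<^sub>0 'f)" where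
  "realize J (PConst a) als Z = pscale a (nest_poly J als Z)"
| "realize J (PVar t) als Z = (if admissible J t
     then alt_poly J (hd als) (pvar(snd (snd t) := pmul (pvar (fst t)) (pvar (fst (snd t))))) (nest_poly J (tl als) Z)
     else 0)"
| "realize J (PAdd P Q) als Z = realize J P als Z + realize J Q als Z"
| "realize J (PMul P Q) als Z = realize J P (take (pexp_degree P) als) (realize J Q (drop (pexp_degree P) als) Z)"

context graded_algebra
begin

definition struct_const :: "('g \<times> nat) set \<Rightarrow> ('g \<times> nat \<Rightarrow> 'u) \<Rightarrow> ('g \<times> nat) \<times> ('g \<times> nat) \<times> ('g \<times> nat) \<Rightarrow> 'f" where
  "struct_const J u t = (if admissible J t then crd J u (mult (u (fst t)) (u (fst (snd t)))) (snd (snd t)) else 0)"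

lemma alt_eval_struct_const:
  assumes b: "graded_basis J u" and en: "enumerates J al" and t: "admissible J (i, j, k)"
  shows "alt_eval J w al (u(k := mult (u i) (u j))) z = scale (struct_const J u (i, j, k)) (alt_eval J w al u z)"
proof -
  have k: "k \<in> J" "fst k = fst i + fst j" using t by (auto simp: admissible_def)
  have "mult (u i) (u j) \<in> comp (fst k)" unfolding k(2) by (intro mult_comp graded_basisD[OF b])
  then have "mult (u i) (u j) = (\<Sum>l | l \<in> J \<and> fst l = fst k. scale (crd J u (mult (u i) (u j)) l) (u l))"
    by (rule crd_sum_homogeneous[OF b])
  then have "alt_eval J w al (u(k := mult (u i) (u j))) z
      = alt_eval J w al (u(k := (\<Sum>l | l \<in> J \<and> fst l = fst k. scale (crd J u (mult (u i) (u j)) l) (u l)))) z"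
    by (rule arg_cong)
  also have "\<dots> = scale (crd J u (mult (u i) (u j)) k) (alt_eval J w al u z)"
    by (rule alt_eval_combination[OF graded_basisD(1)[OF b] en k(1)])
  finally show ?thesis using t by (simp add: struct_const_def)
qed

lemma eval_realize:
  assumes b: "graded_basis J u"
  shows "\<forall>al\<in>set als. enumerates J al \<Longrightarrow> pexp_degree P \<le> length als \<Longrightarrow>
    eval_poly u (realize J P als Z) = scale (pexp_eval (struct_const J u) P) (nest_eval J u als (eval_poly u Z))"
proof (induction P arbitrary: als Z)
  case (PConst a)
  then show ?case by (simp add: eval_poly_pscale eval_nest_poly)
next
  case (PVar t)
  then obtain al bls where als: "als = al # bls" by (cases als) auto
  obtain i j k where t: "t = (i, j, k)" by (cases t) auto
  show ?case
  proof (cases "admissible J t")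
    case True
    have "(\<lambda>x. eval_poly u ((pvar(k := pmul (pvar i) (pvar j))) x)) = u(k := mult (u i) (u j))"
      by (auto simp: eval_poly_pvar eval_poly_pmul)
    then show ?thesis
      using True PVar alt_eval_struct_const[OF b, of al i j k u]
      by (simp add: als t eval_alt_poly eval_nest_poly nest_eval_def del: fun_upd_apply)
  qed (simp add: struct_const_def)
next
  case (PAdd P Q)
  then show ?case by (simp add: eval_poly_add scale_left_distrib)
next
  case (PMul P Q)
  let ?n = "pexp_degree P"
  have "\<forall>al\<in>set (take ?n als). enumerates J al" "\<forall>al\<in>set (drop ?n als). enumerates J al"
    using PMul.prems by (auto dest: in_set_takeD in_set_dropD)
  then have "eval_poly u (realize J (PMul P Q) als Z) = scale (pexp_eval (struct_const J u) P)
      (nest_eval J u (take ?n als) (scale (pexp_eval (struct_const J u) Q) (nest_eval J u (drop ?n als) (eval_poly u Z))))"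
    using PMul by simp
  also have "\<dots> = scale (pexp_eval (struct_const J u) (PMul P Q)) (nest_eval J u (take ?n als @ drop ?n als) (eval_poly u Z))"
    unfolding nest_eval_append by (simp add: nest_eval_scale)
  finally show ?case by simp
qed

end

text \<open>A relation between structure constants that holds for all bases of \<open>U\<close> becomes a
  graded identity \<open>f\<close> of \<open>U\<close> after multiplication with alternators. If the relation failed for
  a basis \<open>v\<close> of \<open>V\<close>, the alternators could be chosen such that \<open>f\<close> does not vanish at \<open>v\<close>,
  and \<open>f\<close> would not be an identity of \<open>V\<close>.\<close>

lemma structure_polynomial_transfer:
  assumes U: "closed_graded_simple_algebra scaleU multU compU"
    and V: "closed_graded_simple_algebra scaleV multV compV"
    and bU: "graded_algebra.graded_basis scaleU compU J u0"
    and id: "\<And>f. graded_algebra.graded_identity scaleU multU compU f \<Longrightarrow> graded_algebra.graded_identity scaleV multV compV f"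
    and P: "\<And>u. graded_algebra.graded_basis scaleU compU J u \<Longrightarrow>
      pexp_eval (graded_algebra.struct_const scaleU multU J u) P = 0"
    and bV: "graded_algebra.graded_basis scaleV compV J v"
  shows "pexp_eval (graded_algebra.struct_const scaleV multV J v) P = 0"
proof (rule ccontr)
  interpret U: closed_graded_simple_algebra scaleU multU compU by (rule U)
  interpret V: closed_graded_simple_algebra scaleV multV compV by (rule V)
  assume nz: "pexp_eval (V.struct_const J v) P \<noteq> 0"
  obtain j where j: "j \<in> J" "v j \<noteq> 0" using V.graded_basis_nonempty[OF bV] by blast
  obtain als where als: "length als = Suc (pexp_degree P)" "\<forall>al\<in>set als. enumerates J al"
    "V.nest_eval J v als (v j) \<noteq> 0"
    using V.exists_alternator_list[OF bV V.graded_basisD(3)[OF bV] j(2)] by blast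
  then obtain al bls where ab: "als = al # bls" by (cases als) auto
  (* the outermost alternator makes f vanish at every graded assignment that is not a basis *)
  define f where "f = alt_poly J al pvar (realize J P bls (pvar j))"
  have bls: "\<forall>al\<in>set bls. enumerates J al" "pexp_degree P \<le> length bls" using als ab by auto
  have "V.eval_poly v f = scaleV (pexp_eval (V.struct_const J v) P) (V.nest_eval J v als (v j))"
    by (simp add: f_def V.eval_alt_poly_pvar V.eval_realize[OF bV bls] V.eval_poly_pvar V.alt_eval_arg_scale ab V.nest_eval_def)
  then have "V.eval_poly v f \<noteq> 0" using nz als(3) by simp
  then have "\<not> V.graded_identity f" using V.graded_basisD(2)[OF bV] by (auto simp: V.graded_identity_iff)
  then have "\<not> U.graded_identity f" using id by blast
  then obtain u where u: "U.graded_assignment u" "U.eval_poly u f \<noteq> 0" by (auto simp: U.graded_identity_iff)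
  then have nzu: "U.alt_eval J u al u (U.eval_poly u (realize J P bls (pvar j))) \<noteq> 0"
    by (simp add: f_def U.eval_alt_poly_pvar)
  have "enumerates J al" using als ab by auto
  from U.alt_eval_nonzero_imp_basis(2)[OF U.graded_basisD(1)[OF bU] this u(1) nzu U.graded_basis_card[OF bU]]
  have b: "U.graded_basis J u" .
  show False using nzu by (simp add: U.eval_realize[OF b bls] P[OF b] U.alt_eval_arg_0)
qed

text \<open>An alternator for \<open>J\<close> that does not vanish on \<open>U\<close> does not vanish on \<open>V\<close> either, and
  where it does not vanish its slots are linearly independent.\<close>

lemma dim_le_of_identities:
  assumes U: "closed_graded_simple_algebra scaleU multU compU"
    and V: "closed_graded_simple_algebra scaleV multV compV"
    and bU: "graded_algebra.graded_basis scaleU compU J u"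
    and id: "\<And>f. graded_algebra.graded_identity scaleV multV compV f \<Longrightarrow> graded_algebra.graded_identity scaleU multU compU f"
  shows "card J \<le> vector_space.dim scaleV UNIV
    \<and> (card J = vector_space.dim scaleV UNIV \<longrightarrow> (\<exists>v. graded_algebra.graded_basis scaleV compV J v))"
proof -
  interpret U: closed_graded_simple_algebra scaleU multU compU by (rule U)
  interpret V: closed_graded_simple_algebra scaleV multV compV by (rule V)
  obtain j where j: "j \<in> J" "u j \<noteq> 0" using U.graded_basis_nonempty[OF bU] by blast
  obtain al where al: "enumerates J al" "U.alt_eval J u al u (u j) \<noteq> 0"
    using U.exists_alternator[OF bU U.graded_basisD(3)[OF bU] j(2)] by blast
  define f where "f = alt_poly J al pvar (pvar j)"
  have "U.eval_poly u f \<noteq> 0" using al by (simp add: f_def U.eval_alt_poly_pvar U.eval_poly_pvar)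
  then have "\<not> U.graded_identity f" using U.graded_basisD(2)[OF bU] by (auto simp: U.graded_identity_iff)
  then have "\<not> V.graded_identity f" using id by blast
  then obtain v where v: "V.graded_assignment v" "V.eval_poly v f \<noteq> 0" by (auto simp: V.graded_identity_iff)
  then have "V.alt_eval J v al v (v j) \<noteq> 0"
    by (simp add: f_def V.eval_alt_poly_pvar V.eval_poly_pvar)
  from V.alt_eval_nonzero_imp_basis[OF U.graded_basisD(1)[OF bU] al(1) v(1) this] show ?thesis by blast
qed

section \<open>Regular functions on the set of bases\<close>

context graded_algebra
begin

inductive_set coord_polys :: "('g \<times> nat) set \<Rightarrow> ('g \<times> nat \<Rightarrow> 'u) \<Rightarrow> (('g \<times> nat \<Rightarrow> 'u) \<Rightarrow> 'f) set"
  for J b where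
  const: "(\<lambda>v. c) \<in> coord_polys J b"
| coord: "j \<in> J \<Longrightarrow> r \<in> J \<Longrightarrow> (\<lambda>v. crd J b (v j) r) \<in> coord_polys J b"
| add: "p \<in> coord_polys J b \<Longrightarrow> q \<in> coord_polys J b \<Longrightarrow> (\<lambda>v. p v + q v) \<in> coord_polys J b"
| mul: "p \<in> coord_polys J b \<Longrightarrow> q \<in> coord_polys J b \<Longrightarrow> (\<lambda>v. p v * q v) \<in> coord_polys J b"

lemma coord_polys_sum: "(\<And>i. i \<in> I \<Longrightarrow> p i \<in> coord_polys J b) \<Longrightarrow> (\<lambda>v. \<Sum>i\<in>I. p i v) \<in> coord_polys J b"
  by (induction I rule: infinite_finite_induct) (auto intro: coord_polys.intros)

lemma coord_polys_on_line:
  assumes b: "graded_basis J b" and "p \<in> coord_polys J b"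
  shows "\<exists>q. \<forall>t. p (\<lambda>j. x j + scale t (y j)) = poly q t"
  using assms(2)
proof (induction rule: coord_polys.induct)
  case (const c)
  then show ?case by (intro exI[of _ "[:c:]"]) simp
next
  case (coord j r)
  then show ?case
    by (intro exI[of _ "[:crd J b (x j) r, crd J b (y j) r:]"]) (simp add: crd_add[OF b] crd_scale[OF b])
next
  case (add p q)
  then obtain p' q' where "\<forall>t. p (\<lambda>j. x j + scale t (y j)) = poly p' t" "\<forall>t. q (\<lambda>j. x j + scale t (y j)) = poly q' t" by blast
  then show ?case by (intro exI[of _ "p' + q'"]) simp
next
  case (mul p q)
  then obtain p' q' where "\<forall>t. p (\<lambda>j. x j + scale t (y j)) = poly p' t" "\<forall>t. q (\<lambda>j. x j + scale t (y j)) = poly q' t" by blast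
  then show ?case by (intro exI[of _ "p' * q'"]) simp
qed

definition coord_poly_map :: "('g \<times> nat) set \<Rightarrow> ('g \<times> nat \<Rightarrow> 'u) \<Rightarrow> (('g \<times> nat \<Rightarrow> 'u) \<Rightarrow> 'u) \<Rightarrow> bool" where
  "coord_poly_map J b h \<longleftrightarrow> (\<forall>r\<in>J. (\<lambda>v. crd J b (h v) r) \<in> coord_polys J b)"

lemma coord_poly_map_const: "coord_poly_map J b (\<lambda>v. w)"
  by (simp add: coord_poly_map_def coord_polys.const)

lemma coord_poly_map_var: "j \<in> J \<Longrightarrow> coord_poly_map J b (\<lambda>v. v j)"
  by (simp add: coord_poly_map_def coord_polys.coord)

lemma coord_poly_map_scale_sum:
  assumes b: "graded_basis J b" and "\<And>i. i \<in> I \<Longrightarrow> coord_poly_map J b (h i)"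
  shows "coord_poly_map J b (\<lambda>v. \<Sum>i\<in>I. scale (c i) (h i v))"
  using assms(2) unfolding coord_poly_map_def
  by (simp add: crd_sum_dist[OF b] crd_scale[OF b] coord_polys_sum coord_polys.mul coord_polys.const)

lemma coord_poly_map_mop:
  assumes b: "graded_basis J b" and h: "coord_poly_map J b h"
  shows "coord_poly_map J b (\<lambda>v. mop_eval u D (h v))"
  unfolding coord_poly_map_def
proof
  fix r assume r: "r \<in> J"
  have eq: "crd J b (mop_eval u D w) r = (\<Sum>s\<in>J. crd J b w s * crd J b (mop_eval u D (b s)) r)" for w
  proof -
    have "mop_eval u D w = (\<Sum>s\<in>J. scale (crd J b w s) (mop_eval u D (b s)))"
      by (subst crd_sum[OF b, of w]) (simp only: mop.sum mop.scale)
    then show ?thesis by (simp only: crd_sum_dist[OF b r] crd_scale[OF b r])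
  qed
  show "(\<lambda>v. crd J b (mop_eval u D (h v)) r) \<in> coord_polys J b"
    by (subst eq) (use h in \<open>simp add: coord_poly_map_def coord_polys_sum coord_polys.mul coord_polys.const\<close>)
qed

lemma coord_poly_map_mult:
  assumes b: "graded_basis J b" and h: "coord_poly_map J b h" "coord_poly_map J b h'"
  shows "coord_poly_map J b (\<lambda>v. mult (h v) (h' v))"
  unfolding coord_poly_map_def
proof
  fix r assume r: "r \<in> J"
  have eq: "crd J b (mult w w') r = (\<Sum>s\<in>J. crd J b w s * (\<Sum>t\<in>J. crd J b w' t * crd J b (mult (b s) (b t)) r))" for w w'
  proof -
    have "mult w w' = (\<Sum>s\<in>J. scale (crd J b w s) (mult (b s) w'))"
      by (subst crd_sum[OF b, of w]) (simp only: ml.sum ml.scale)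
    moreover have "mult (b s) w' = (\<Sum>t\<in>J. scale (crd J b w' t) (mult (b s) (b t)))" for s
      by (subst crd_sum[OF b, of w']) (simp only: mr.sum mr.scale)
    ultimately show ?thesis by (simp only: crd_sum_dist[OF b r] crd_scale[OF b r])
  qed
  show "(\<lambda>v. crd J b (mult (h v) (h' v)) r) \<in> coord_polys J b"
    by (subst eq) (use h in \<open>simp add: coord_poly_map_def coord_polys_sum coord_polys.mul coord_polys.const\<close>)
qed

lemma coord_poly_map_alt:
  assumes b: "graded_basis J b" and en: "enumerates J al" and S: "\<And>j. j \<in> J \<Longrightarrow> coord_poly_map J b (\<lambda>v. S v j)"
  shows "coord_poly_map J b (\<lambda>v. alt_eval J u al (S v) z)"
  unfolding alt_eval_def
proof (rule coord_poly_map_scale_sum[OF b])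
  fix \<sigma> assume "\<sigma> \<in> deg_perms J"
  then have \<sigma>: "\<sigma> j \<in> J" if "j \<in> J" for j using that permutes_in_image[of \<sigma> J j] by (simp add: deg_perms_def)
  have "fst ` set bl \<subseteq> J \<Longrightarrow> coord_poly_map J b (\<lambda>v. term_eval u (S v \<circ> \<sigma>) bl z)" for bl
    by (induction bl) (auto intro!: coord_poly_map_const coord_poly_map_mult[OF b] coord_poly_map_mop[OF b] S \<sigma>)
  then show "coord_poly_map J b (\<lambda>v. term_eval u (S v \<circ> \<sigma>) al z)" using en by (simp add: enumerates_def)
qed

text \<open>Functions on the set of bases that are locally quotients of polynomials. The
  denominators depend on the point \<open>x\<close>, since the alternator that serves as a discriminant is
  adapted to one basis.\<close>

definition regular :: "('g \<times> nat) set \<Rightarrow> ('g \<times> nat \<Rightarrow> 'u) \<Rightarrow> (('g \<times> nat \<Rightarrow> 'u) \<Rightarrow> 'f) \<Rightarrow> bool" where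
  "regular J b f \<longleftrightarrow> (\<forall>x. graded_basis J x \<longrightarrow> (\<exists>d\<in>coord_polys J b. \<exists>p\<in>coord_polys J b.
     d x \<noteq> 0 \<and> (\<forall>v. graded_basis J v \<longrightarrow> f v * d v = p v)))"

lemma regular_coord_poly: "p \<in> coord_polys J b \<Longrightarrow> regular J b p"
  unfolding regular_def
  by (intro allI impI bexI[of _ "\<lambda>v. 1"] bexI[of _ p] conjI) (simp_all add: coord_polys.const)

lemma regular_add:
  assumes "regular J b f" "regular J b g"
  shows "regular J b (\<lambda>v. f v + g v)"
  unfolding regular_def
proof (intro allI impI)
  fix x assume x: "graded_basis J x"
  obtain d p where 1: "d \<in> coord_polys J b" "p \<in> coord_polys J b" "d x \<noteq> 0" "\<And>v. graded_basis J v \<Longrightarrow> f v * d v = p v"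
    using assms(1) x unfolding regular_def by blast
  obtain e q where 2: "e \<in> coord_polys J b" "q \<in> coord_polys J b" "e x \<noteq> 0" "\<And>v. graded_basis J v \<Longrightarrow> g v * e v = q v"
    using assms(2) x unfolding regular_def by blast
  show "\<exists>d\<in>coord_polys J b. \<exists>p\<in>coord_polys J b. d x \<noteq> 0 \<and> (\<forall>v. graded_basis J v \<longrightarrow> (f v + g v) * d v = p v)"
  proof (intro bexI conjI allI impI)
    show "(f v + g v) * (d v * e v) = p v * e v + q v * d v" if "graded_basis J v" for v
      using 1(4)[OF that] 2(4)[OF that] by (simp flip: 1(4)[OF that] 2(4)[OF that] add: algebra_simps)
  qed (use 1 2 in \<open>auto intro!: coord_polys.add coord_polys.mul\<close>)
qed

lemma regular_mul:
  assumes "regular J b f" "regular J b g"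
  shows "regular J b (\<lambda>v. f v * g v)"
  unfolding regular_def
proof (intro allI impI)
  fix x assume x: "graded_basis J x"
  obtain d p where 1: "d \<in> coord_polys J b" "p \<in> coord_polys J b" "d x \<noteq> 0" "\<And>v. graded_basis J v \<Longrightarrow> f v * d v = p v"
    using assms(1) x unfolding regular_def by blast
  obtain e q where 2: "e \<in> coord_polys J b" "q \<in> coord_polys J b" "e x \<noteq> 0" "\<And>v. graded_basis J v \<Longrightarrow> g v * e v = q v"
    using assms(2) x unfolding regular_def by blast
  show "\<exists>d\<in>coord_polys J b. \<exists>p\<in>coord_polys J b. d x \<noteq> 0 \<and> (\<forall>v. graded_basis J v \<longrightarrow> (f v * g v) * d v = p v)"
  proof (intro bexI conjI allI impI)
    show "(f v * g v) * (d v * e v) = p v * q v" if "graded_basis J v" for v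
      by (simp flip: 1(4)[OF that] 2(4)[OF that] add: algebra_simps)
  qed (use 1 2 in \<open>auto intro!: coord_polys.mul\<close>)
qed

end

text \<open>The affine space of graded assignments is irreducible: on the line through \<open>x\<close> and \<open>y\<close>
  both functions become nonzero polynomials in one variable over an infinite field.\<close>

lemma (in closed_graded_simple_algebra) coord_polys_common_nonzero:
  assumes b: "graded_basis J b" and p: "p \<in> coord_polys J b" "p x \<noteq> 0" and q: "q \<in> coord_polys J b" "q y \<noteq> 0"
    and xy: "graded_assignment x" "graded_assignment y"
  shows "\<exists>z. graded_assignment z \<and> p z \<noteq> 0 \<and> q z \<noteq> 0"
proof -
  define l where "l t j = x j + scale t (y j - x j)" for t j
  obtain p' where p': "\<And>t. p (l t) = poly p' t"
    using coord_polys_on_line[OF b p(1), of x "\<lambda>j. y j - x j"] unfolding l_def by blast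
  obtain q' where q': "\<And>t. q (l t) = poly q' t"
    using coord_polys_on_line[OF b q(1), of x "\<lambda>j. y j - x j"] unfolding l_def by blast
  have "l 0 = x" "l 1 = y" by (auto simp: l_def)
  then have "poly p' 0 \<noteq> 0" "poly q' 1 \<noteq> 0" using p'[of 0] q'[of 1] p(2) q(2) by simp_all
  then have "p' * q' \<noteq> 0" by auto
  then obtain t where "poly (p' * q') t \<noteq> 0" using poly_nonroot by blast
  then have "p (l t) \<noteq> 0" "q (l t) \<noteq> 0" using p' q' by auto
  moreover have "graded_assignment (l t)"
    using xy unfolding graded_assignment_def l_def
    by (auto intro!: subspace_add[OF subspace_comp] subspace_scale[OF subspace_comp] subspace_diff[OF subspace_comp])
  ultimately show ?thesis by blast
qed

context closed_graded_simple_algebra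
begin

text \<open>A coordinate of an alternator with fixed operators and fixed argument is a polynomial
  in its slots. It plays the part of the determinant: it can be chosen to be nonzero at a
  given basis, and it vanishes at all the assignments that are not bases.\<close>

lemma basis_discriminant:
  assumes b: "graded_basis J b" and x: "graded_basis J x"
  shows "\<exists>al z r. enumerates J al \<and> r \<in> J \<and> crd J b (alt_eval J x al x z) r \<noteq> 0"
proof -
  obtain j where j: "j \<in> J" "x j \<noteq> 0" using graded_basis_nonempty[OF x] by blast
  obtain al where al: "enumerates J al" "alt_eval J x al x (x j) \<noteq> 0"
    using exists_alternator[OF x graded_basisD(3)[OF x] j(2)] by blast
  have "\<exists>r\<in>J. crd J b (alt_eval J x al x (x j)) r \<noteq> 0"
  proof (rule ccontr)
    assume "\<not> ?thesis"
    then have "alt_eval J x al x (x j) = 0" by (intro crd_ext[OF b]) (simp add: crd_0[OF b])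
    then show False using al by simp
  qed
  then show ?thesis using al by blast
qed

lemma discriminant_basis:
  assumes b: "graded_basis J b" and "enumerates J al" "r \<in> J" and v: "graded_assignment v"
    and nz: "crd J b (alt_eval J x al v z) r \<noteq> 0"
  shows "graded_basis J v"
proof -
  have "alt_eval J x al v z \<noteq> 0" using nz crd_0[OF b assms(3)] by auto
  then have indep: "c k = 0" if "(\<Sum>j\<in>J. scale (c j) (v j)) = 0" "k \<in> J" for c k
    using alt_eval_nonzero_imp_independent[OF graded_basisD(1)[OF b] assms(2) v _ that] by blast
  have "\<exists>c. w = (\<Sum>j\<in>J. scale (c j) (v j))" for w
    by (rule family_card_le_dim(2)[of J v, OF graded_basisD(1)[OF b] _ graded_basis_card[OF b]]) (rule indep)
  then show ?thesis using v indep graded_basisD(1)[OF b] unfolding graded_basis_def by blast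
qed

text \<open>By Cramer's rule the coordinate \<open>k\<close> of \<open>h v\<close> with respect to \<open>v\<close> is the quotient of
  the discriminant with \<open>h v\<close> in the slot \<open>k\<close> by the discriminant itself.\<close>

lemma regular_crd:
  assumes b: "graded_basis J b" and h: "coord_poly_map J b h"
    and deg: "\<And>v. graded_basis J v \<Longrightarrow> h v \<in> comp g" and k: "k \<in> J"
  shows "regular J b (\<lambda>v. crd J v (h v) k)"
proof (cases "fst k = g")
  case False
  then have "crd J v (h v) k = 0" if "graded_basis J v" for v
    using crd_homogeneous[OF that deg[OF that] k] by blast
  moreover have "regular J b (\<lambda>v. 0)" by (intro regular_coord_poly coord_polys.const)
  ultimately show ?thesis unfolding regular_def by simp
next
  case True
  show ?thesis unfolding regular_def
  proof (intro allI impI)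
    fix x assume x: "graded_basis J x"
    obtain al z r where al: "enumerates J al" "r \<in> J" "crd J b (alt_eval J x al x z) r \<noteq> 0"
      using basis_discriminant[OF b x] by blast
    have "crd J v (h v) k * crd J b (alt_eval J x al v z) r = crd J b (alt_eval J x al (v(k := h v)) z) r"
      if v: "graded_basis J v" for v
    proof -
      have "h v = (\<Sum>l | l \<in> J \<and> fst l = fst k. scale (crd J v (h v) l) (v l))"
        using crd_sum_homogeneous[OF v deg[OF v]] unfolding True .
      then have "alt_eval J x al (v(k := h v)) z
          = alt_eval J x al (v(k := (\<Sum>l | l \<in> J \<and> fst l = fst k. scale (crd J v (h v) l) (v l)))) z"
        by (rule arg_cong)
      then show ?thesis
        by (simp only: alt_eval_combination[OF graded_basisD(1)[OF b] al(1) k] crd_scale[OF b al(2)])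
    qed
    moreover have "coord_poly_map J b (\<lambda>v. alt_eval J x al v z)"
      by (rule coord_poly_map_alt[OF b al(1)]) (rule coord_poly_map_var)
    moreover have "coord_poly_map J b (\<lambda>v. alt_eval J x al (v(k := h v)) z)"
    proof (rule coord_poly_map_alt[OF b al(1)])
      fix j assume "j \<in> J"
      then show "coord_poly_map J b (\<lambda>v. (v(k := h v)) j)"
        by (cases "j = k") (simp_all add: h coord_poly_map_var)
    qed
    ultimately show "\<exists>d\<in>coord_polys J b. \<exists>p\<in>coord_polys J b. d x \<noteq> 0 \<and>
        (\<forall>v. graded_basis J v \<longrightarrow> crd J v (h v) k * d v = p v)"
      using al(2,3) unfolding coord_poly_map_def
      by (intro bexI[of _ "\<lambda>v. crd J b (alt_eval J x al v z) r"]
          bexI[of _ "\<lambda>v. crd J b (alt_eval J x al (v(k := h v)) z) r"]) auto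
  qed
qed

text \<open>After multiplication with denominators and with a discriminant this is the
  irreducibility of affine space.\<close>

lemma regular_no_zero_divisors:
  assumes b: "graded_basis J b" and f: "regular J b f" and g: "regular J b g"
    and fg: "\<And>v. graded_basis J v \<Longrightarrow> f v * g v = 0"
    and x: "graded_basis J x" "f x \<noteq> 0" and y: "graded_basis J y"
  shows "g y = 0"
proof (rule ccontr)
  assume gy: "g y \<noteq> 0"
  obtain d p where 1: "p \<in> coord_polys J b" "d x \<noteq> 0" "\<And>v. graded_basis J v \<Longrightarrow> f v * d v = p v"
    using f x(1) unfolding regular_def by blast
  obtain e q where 2: "q \<in> coord_polys J b" "e y \<noteq> 0" "\<And>v. graded_basis J v \<Longrightarrow> g v * e v = q v"
    using g y unfolding regular_def by blast
  obtain al z r where al: "enumerates J al" "r \<in> J" "crd J b (alt_eval J x al x z) r \<noteq> 0"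
    using basis_discriminant[OF b x(1)] by blast
  have "coord_poly_map J b (\<lambda>v. alt_eval J x al v z)"
    by (rule coord_poly_map_alt[OF b al(1)]) (rule coord_poly_map_var)
  then have "(\<lambda>v. crd J b (alt_eval J x al v z) r * p v) \<in> coord_polys J b"
    using al(2) 1(1) unfolding coord_poly_map_def by (intro coord_polys.mul) blast+
  moreover have "crd J b (alt_eval J x al x z) r * p x \<noteq> 0" using al(3) x 1(2) by (simp flip: 1(3)[OF x(1)])
  moreover have "q y \<noteq> 0" using gy 2(2) by (simp flip: 2(3)[OF y])
  ultimately obtain v where v: "graded_assignment v" "crd J b (alt_eval J x al v z) r * p v \<noteq> 0" "q v \<noteq> 0"
    using coord_polys_common_nonzero[OF b _ _ 2(1) _ graded_basisD(2)[OF x(1)] graded_basisD(2)[OF y]] by blast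
  then have bv: "graded_basis J v" using discriminant_basis[OF b al(1,2) v(1), of x z] by simp
  then have "f v \<noteq> 0" "g v \<noteq> 0" using v 1(3)[OF bv] 2(3)[OF bv] by auto
  then show False using fg[OF bv] by simp
qed

lemma crd_mult_basis:
  assumes "graded_basis J v" "i \<in> J" "j \<in> J" "k \<in> J"
  shows "crd J v (mult (v i) (v j)) k = struct_const J v (i, j, k)"
  using assms crd_homogeneous[OF assms(1) mult_comp[OF graded_basisD(3)[OF assms(1)] graded_basisD(3)[OF assms(1)]] assms(4), of i j]
  by (auto simp: struct_const_def admissible_def)

section \<open>Lifting a generic point to a basis\<close>

text \<open>The condition on \<open>c\<close> says that \<open>c\<close> lies in the Zariski closure of the set of structure
  constants of all bases, and \<open>Q\<close> cuts out an open subset of that closure. Let \<open>A\<close> be the ring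
  of functions on the bases generated by the structure constants; evaluation at \<open>c\<close> is a
  homomorphism on \<open>A\<close>. The regular functions form an integral domain that contains \<open>A\<close> and the
  coordinate changes between \<open>v\<close> and \<open>b\<close>. So the extension theorem yields \<open>Q\<close>, and for
  \<open>Q(c) \<noteq> 0\<close> a homomorphism on the larger ring. The images of the coordinates define
  the basis \<open>w\<close>, whose multiplication table is forced to be \<open>c\<close>.\<close>

theorem structure_constants_of_generic_point:
  assumes b: "graded_basis J b"
  shows "\<exists>Q. (\<exists>v. graded_basis J v \<and> pexp_eval (struct_const J v) Q \<noteq> 0) \<and>
    (\<forall>c. pexp_eval c Q \<noteq> 0 \<longrightarrow>
      (\<forall>P. (\<forall>v. graded_basis J v \<longrightarrow> pexp_eval (struct_const J v) P = 0) \<longrightarrow> pexp_eval c P = 0) \<longrightarrow>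
      (\<exists>v. graded_basis J v \<and> struct_const J v = c))"
proof -
  (* R f agrees with f on the bases and takes the value f b elsewhere, so that an equation between
     functions of the form R f is an equation between their values on the bases. *)
  define \<rho> where "\<rho> v = (if graded_basis J v then v else b)" for v
  have \<rho>: "graded_basis J (\<rho> v)" for v using b by (simp add: \<rho>_def)
  have \<rho>_id: "\<rho> v = v" if "graded_basis J v" for v using that by (simp add: \<rho>_def)
  define R where "R f = (\<lambda>v. f (\<rho> v) :: 'f)" for f
  have R_eq: "R f = R g \<longleftrightarrow> (\<forall>v. graded_basis J v \<longrightarrow> f v = g v)" for f g
  proof
    assume e: "R f = R g"
    show "\<forall>v. graded_basis J v \<longrightarrow> f v = g v"
    proof (intro allI impI)
      fix v assume v: "graded_basis J v"
      show "f v = g v" using fun_cong[OF e, of v] by (simp add: R_def \<rho>_id[OF v])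
    qed
  next
    assume "\<forall>v. graded_basis J v \<longrightarrow> f v = g v"
    then show "R f = R g" using \<rho> by (simp add: R_def)
  qed
  have R_arith: "R (\<lambda>v. 1) = 1" "R (\<lambda>v. 0) = 0" "R f + R g = R (\<lambda>v. f v + g v)" "R f * R g = R (\<lambda>v. f v * g v)"
    "R f - R g = R (\<lambda>v. f v + (-1) * g v)" for f g
    by (auto simp: R_def fun_eq_iff)
  have R_sum: "(\<Sum>i\<in>I. R (F i)) = R (\<lambda>v. \<Sum>i\<in>I. F i v)" for F :: "'g \<times> nat \<Rightarrow> _" and I
    by (induction I rule: infinite_finite_induct) (simp_all add: R_arith)
  have R_0: "R f = 0 \<longleftrightarrow> (\<forall>v. graded_basis J v \<longrightarrow> f v = 0)" for f
    unfolding R_arith(2)[symmetric] by (rule R_eq)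
  define B where "B = {R f | f. regular J b f}"
  define E where "E P = R (\<lambda>v. pexp_eval (struct_const J v) P)" for P
  define A where "A = range E"
  have regc: "regular J b (\<lambda>v. c)" for c by (intro regular_coord_poly coord_polys.const)
  have B: "is_subring B" unfolding is_subring_def
  proof (intro conjI ballI)
    show "1 \<in> B" unfolding B_def R_arith(1)[symmetric] using regc by blast
    fix x y assume "x \<in> B" "y \<in> B"
    then obtain f g where fg: "x = R f" "y = R g" "regular J b f" "regular J b g" by (auto simp: B_def)
    show "x - y \<in> B" unfolding fg R_arith B_def using regular_add[OF fg(3) regular_mul[OF regc fg(4)]] by blast
    show "x * y \<in> B" unfolding fg R_arith B_def using regular_mul[OF fg(3,4)] by blast
  qed
  have dom: "no_zero_divisors_on B" unfolding no_zero_divisors_on_def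
  proof (intro ballI impI)
    fix x y assume "x \<in> B" "y \<in> B" and xy: "x * y = 0"
    then obtain f g where fg: "x = R f" "y = R g" "regular J b f" "regular J b g" by (auto simp: B_def)
    have "f v * g v = 0" if "graded_basis J v" for v using xy that unfolding fg R_arith R_0 by blast
    from regular_no_zero_divisors[OF b fg(3,4) this] show "x = 0 \<or> y = 0" unfolding fg R_0 by blast
  qed
  have E_arith: "E (PConst c) = R (\<lambda>v. c)" "E P + E Q = E (PAdd P Q)" "E P * E Q = E (PMul P Q)"
    "E P - E Q = E (PAdd P (PMul (PConst (-1)) Q))" for c P Q
    by (simp_all only: E_def R_arith pexp_eval.simps)
  have A: "is_subring A" unfolding is_subring_def A_def
  proof (intro conjI ballI)
    show "1 \<in> range E" using E_arith(1)[of 1] R_arith(1) by (metis rangeI)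
  qed (auto simp: E_arith)
  have reg_sc: "regular J b (\<lambda>v. struct_const J v t)" for t
  proof (cases "admissible J t")
    case True
    then have t: "fst t \<in> J" "fst (snd t) \<in> J" "snd (snd t) \<in> J" by (auto simp: admissible_def)
    have "coord_poly_map J b (\<lambda>v. mult (v (fst t)) (v (fst (snd t))))"
      by (intro coord_poly_map_mult[OF b] coord_poly_map_var t)
    then have "regular J b (\<lambda>v. crd J v (mult (v (fst t)) (v (fst (snd t)))) (snd (snd t)))"
      by (rule regular_crd[OF b _ _ t(3), where g = "fst (fst t) + fst (fst (snd t))"])
        (intro mult_comp graded_basisD(3))
    then show ?thesis using True by (simp add: struct_const_def)
  next
    case False
    then show ?thesis using regc by (simp add: struct_const_def)
  qed
  have "regular J b (\<lambda>v. pexp_eval (struct_const J v) P)" for P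
    by (induction P) (simp_all add: regc reg_sc regular_add regular_mul)
  then have AB: "A \<subseteq> B" unfolding A_def B_def E_def by blast
  (* The matrices eta and theta are inverse to each other: they change coordinates between b and v.
     Adjoining both makes the images of eta under a homomorphism the coordinates of a basis. *)
  define \<eta> where "\<eta> j s = R (\<lambda>v. crd J b (v j) s)" for j s
  define \<theta> where "\<theta> s k = R (\<lambda>v. crd J v (b s) k)" for s k
  obtain js where js: "set js = J" using finite_list[OF graded_basisD(1)[OF b]] by blast
  define ys where "ys = map (\<lambda>(j, s). \<eta> j s) (List.product js js) @ map (\<lambda>(s, k). \<theta> s k) (List.product js js)"
  have ys: "set ys = (\<lambda>(j, s). \<eta> j s) ` (J \<times> J) \<union> (\<lambda>(s, k). \<theta> s k) ` (J \<times> J)" by (simp add: ys_def js)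
  have "\<eta> j s \<in> B" "\<theta> j s \<in> B" if "j \<in> J" "s \<in> J" for j s
    using that regular_coord_poly[OF coord_polys.coord] regular_crd[OF b coord_poly_map_const graded_basisD(3)[OF b]]
    unfolding B_def \<eta>_def \<theta>_def by blast+
  then have ysB: "set ys \<subseteq> B" unfolding ys by auto
  have C: "is_subring (adjoin_list A ys)" "A \<subseteq> adjoin_list A ys" "set ys \<subseteq> adjoin_list A ys"
    using subring_adjoin_list[OF A, of ys] by auto
  have "(1 :: ('g \<times> nat \<Rightarrow> 'u) \<Rightarrow> 'f) \<noteq> 0" by simp
  from hom_extension[OF A AB B dom ysB subring_closed(1)[OF C(1)] this]
  obtain a where a: "a \<in> A" "a \<noteq> 0" and ext: "\<And>\<phi> :: _ \<Rightarrow> 'f. ring_hom_on A \<phi> \<Longrightarrow> \<phi> a \<noteq> 0 \<Longrightarrow>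
     \<exists>\<psi>. ring_hom_on (adjoin_list A ys) \<psi> \<and> (\<forall>x\<in>A. \<psi> x = \<phi> x)" by blast
  obtain Q where Q: "a = E Q" using a(1) by (auto simp: A_def)
  show ?thesis
  proof (intro exI[of _ Q] conjI allI impI)
    show "\<exists>v. graded_basis J v \<and> pexp_eval (struct_const J v) Q \<noteq> 0"
      using a(2) unfolding Q E_def R_0 by blast
    fix c assume cQ: "pexp_eval c Q \<noteq> 0"
      and van: "\<forall>P. (\<forall>v. graded_basis J v \<longrightarrow> pexp_eval (struct_const J v) P = 0) \<longrightarrow> pexp_eval c P = 0"
    (* By the hypothesis on c, evaluation at c is well defined on the elements of A. *)
    define \<phi> where "\<phi> x = pexp_eval c (SOME P. E P = x)" for x
    have \<phi>: "\<phi> (E P) = pexp_eval c P" for P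
    proof -
      define P' where "P' = (SOME P'. E P' = E P)"
      have "E P' = E P" unfolding P'_def by (rule someI) (rule refl)
      then have "\<forall>v. graded_basis J v \<longrightarrow> pexp_eval (struct_const J v) P' = pexp_eval (struct_const J v) P"
        unfolding E_def R_eq .
      then have "\<forall>v. graded_basis J v \<longrightarrow> pexp_eval (struct_const J v) (PAdd P' (PMul (PConst (-1)) P)) = 0"
        by simp
      then have "pexp_eval c (PAdd P' (PMul (PConst (-1)) P)) = 0" using van by blast
      then show ?thesis by (simp add: \<phi>_def P'_def[symmetric])
    qed
    have "ring_hom_on A \<phi>" unfolding ring_hom_on_def A_def
    proof (intro conjI ballI)
      show "\<phi> 1 = 1" using \<phi>[of "PConst 1"] by (simp add: E_arith R_arith)
    qed (auto simp: E_arith \<phi>)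
    moreover have "\<phi> a \<noteq> 0" using cQ by (simp add: Q \<phi>)
    ultimately obtain \<psi> where \<psi>: "ring_hom_on (adjoin_list A ys) \<psi>" and "\<forall>x\<in>A. \<psi> x = \<phi> x" using ext by blast
    then have \<psi>E: "\<psi> (E P) = pexp_eval c P" for P using \<phi> by (simp add: A_def)
    note H = ring_hom_on_arith[OF C(1) \<psi>] and S = subring_closed[OF C(1)]
    have in_ys: "\<eta> j s \<in> adjoin_list A ys" "\<theta> j s \<in> adjoin_list A ys" if "j \<in> J" "s \<in> J" for j s
      using that C(3) unfolding ys by auto
    have in_E: "E P \<in> adjoin_list A ys" for P using C(2) by (auto simp: A_def)
    define w where "w j = (if j \<in> J then \<Sum>s\<in>J. scale (\<psi> (\<eta> j s)) (b s) else 0)" for j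
    have crdw: "crd J b (w j) s = \<psi> (\<eta> j s)" if "j \<in> J" "s \<in> J" for j s
      by (rule crd_eqI[OF b _ that(2)]) (simp add: w_def that)
    have poly_in: "R p \<in> adjoin_list A ys \<and> \<psi> (R p) = p w" if "p \<in> coord_polys J b" for p
      using that
    proof (induction rule: coord_polys.induct)
      case (const a)
      show ?case using in_E[of "PConst a"] \<psi>E[of "PConst a"] by (simp add: E_arith)
    next
      case (coord j r)
      then show ?case using in_ys(1)[OF coord] crdw[OF coord] by (simp add: \<eta>_def)
    next
      case (add p q)
      then show ?case unfolding R_arith(3)[symmetric]
        using H(3)[of "R p" "R q"] S(6)[of "R p" "R q"] by (simp only: simp_thms)
    next
      case (mul p q)
      then show ?case unfolding R_arith(4)[symmetric]
        using H(4)[of "R p" "R q"] S(4)[of "R p" "R q"] by (simp only: simp_thms)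
    qed
    have gw: "graded_assignment w" unfolding graded_assignment_def
    proof
      fix j
      have "scale (\<psi> (\<eta> j s)) (b s) \<in> comp (fst j)" if j: "j \<in> J" and s: "s \<in> J" for s
      proof (cases "fst s = fst j")
        case True
        then show ?thesis using graded_basisD(3)[OF b, of s] by (simp add: subspace_scale[OF subspace_comp])
      next
        case False
        then have "\<eta> j s = 0" unfolding \<eta>_def R_0
          using crd_homogeneous[OF b graded_basisD(3) s] by blast
        then show ?thesis using H(2) subspace_0[OF subspace_comp] by simp
      qed
      then show "w j \<in> comp (fst j)" unfolding w_def
        using subspace_0[OF subspace_comp] by (auto intro!: subspace_sum[OF subspace_comp])
    qed
    have inverse: "(\<Sum>s\<in>J. \<psi> (\<eta> j s) * \<psi> (\<theta> s k)) = (if k = j then 1 else 0)" if jk: "j \<in> J" "k \<in> J" for j k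
    proof -
      have "(\<Sum>s\<in>J. crd J b (v j) s * crd J v (b s) k) = (if k = j then 1 else 0)" if v: "graded_basis J v" for v
      proof -
        have "crd J v (v j) k = crd J v (\<Sum>s\<in>J. scale (crd J b (v j) s) (b s)) k"
          using crd_sum[OF b, of "v j"] by (rule arg_cong)
        then show ?thesis using crd_basis[OF v jk(2,1)] by (simp only: crd_sum_dist[OF v jk(2)] crd_scale[OF v jk(2)])
      qed
      then have "(\<Sum>s\<in>J. \<eta> j s * \<theta> s k) = R (\<lambda>v. if k = j then 1 else 0)"
        unfolding \<eta>_def \<theta>_def R_arith R_sum R_eq by blast
      then have "\<psi> (\<Sum>s\<in>J. \<eta> j s * \<theta> s k) = (if k = j then 1 else 0)" using H(1,2) by (simp add: R_arith)
      moreover have "\<psi> (\<Sum>s\<in>J. \<eta> j s * \<theta> s k) = (\<Sum>s\<in>J. \<psi> (\<eta> j s) * \<psi> (\<theta> s k))"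
        using jk by (simp add: ring_hom_on_sum[OF C(1) \<psi>] S in_ys H)
      ultimately show ?thesis by simp
    qed
    have indep: "d k = 0" if rel: "(\<Sum>j\<in>J. scale (d j) (w j)) = 0" and k: "k \<in> J" for d k
    proof -
      have "(\<Sum>j\<in>J. d j * \<psi> (\<eta> j s)) = 0" if s: "s \<in> J" for s
      proof -
        have "crd J b (\<Sum>j\<in>J. scale (d j) (w j)) s = (\<Sum>j\<in>J. d j * \<psi> (\<eta> j s))"
          using s by (simp add: crd_sum_dist[OF b] crd_scale[OF b] crdw)
        then show ?thesis using rel crd_0[OF b s] by simp
      qed
      then have "0 = (\<Sum>s\<in>J. (\<Sum>j\<in>J. d j * \<psi> (\<eta> j s)) * \<psi> (\<theta> s k))" by simp
      also have "\<dots> = (\<Sum>j\<in>J. d j * (\<Sum>s\<in>J. \<psi> (\<eta> j s) * \<psi> (\<theta> s k)))"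
        unfolding sum_distrib_right sum_distrib_left by (subst sum.swap) (simp add: mult.assoc)
      also have "\<dots> = (\<Sum>j\<in>J. if j = k then d j else 0)" using k by (intro sum.cong) (simp_all add: inverse)
      also have "\<dots> = d k" using k graded_basisD(1)[OF b] by simp
      finally show ?thesis by simp
    qed
    have "\<exists>d. x = (\<Sum>j\<in>J. scale (d j) (w j))" for x
      by (rule family_card_le_dim(2)[of J w, OF graded_basisD(1)[OF b] _ graded_basis_card[OF b]]) (rule indep)
    then have bw: "graded_basis J w"
      unfolding graded_basis_def using gw indep graded_basisD(1)[OF b] by blast
    have c0: "c t = 0" if "\<not> admissible J t" for t
      using van[rule_format, of "PVar t"] that by (simp add: struct_const_def)
    have table: "mult (w i) (w j) = (\<Sum>k\<in>J. scale (c (i, j, k)) (w k))" if ij: "i \<in> J" "j \<in> J" for i j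
    proof (rule crd_ext[OF b])
      fix r assume r: "r \<in> J"
      (* The multiplication table in coordinates is a polynomial relation between structure
         constants and coordinates, which psi carries over from the bases v to w. *)
      define m where "m v = crd J b (mult (v i) (v j)) r" for v
      have "coord_poly_map J b (\<lambda>v. mult (v i) (v j))"
        by (intro coord_poly_map_mult[OF b] coord_poly_map_var ij)
      then have m: "m \<in> coord_polys J b" unfolding m_def coord_poly_map_def using r by blast
      have "m v = (\<Sum>k\<in>J. struct_const J v (i, j, k) * crd J b (v k) r)" if v: "graded_basis J v" for v
      proof -
        have "m v = crd J b (\<Sum>k\<in>J. scale (crd J v (mult (v i) (v j)) k) (v k)) r"
          unfolding m_def using crd_sum[OF v, of "mult (v i) (v j)"] by (rule arg_cong)
        then show ?thesis
          using ij by (simp add: crd_sum_dist[OF b r] crd_scale[OF b r] crd_mult_basis[OF v])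
      qed
      then have Rm: "R m = (\<Sum>k\<in>J. E (PVar (i, j, k)) * \<eta> k r)"
        unfolding \<eta>_def E_def R_arith R_sum R_eq pexp_eval.simps by blast
      have "crd J b (mult (w i) (w j)) r = \<psi> (R m)" using poly_in[OF m] by (simp add: m_def)
      also have "\<dots> = (\<Sum>k\<in>J. c (i, j, k) * crd J b (w k) r)"
        unfolding Rm using r by (simp add: ring_hom_on_sum[OF C(1) \<psi>] S in_ys in_E H \<psi>E crdw)
      also have "\<dots> = crd J b (\<Sum>k\<in>J. scale (c (i, j, k)) (w k)) r"
        by (simp add: crd_sum_dist[OF b r] crd_scale[OF b r])
      finally show "crd J b (mult (w i) (w j)) r = crd J b (\<Sum>k\<in>J. scale (c (i, j, k)) (w k)) r" .
    qed
    have "struct_const J w t = c t" for t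
    proof (cases "admissible J t")
      case True
      obtain i j k where t: "t = (i, j, k)" by (cases t) auto
      have "crd J w (mult (w i) (w j)) k = c (i, j, k)"
        using True by (intro crd_eqI[OF bw table]) (auto simp: admissible_def t)
      then show ?thesis using True by (simp add: struct_const_def t)
    next
      case False
      then show ?thesis by (simp add: struct_const_def c0)
    qed
    then show "\<exists>v. graded_basis J v \<and> struct_const J v = c" using bw by blast
  qed
qed

end

section \<open>Isomorphism and identities\<close>

lemma graded_isomorphic_of_struct_const:
  assumes U: "closed_graded_simple_algebra scaleU multU compU"
    and V: "closed_graded_simple_algebra scaleV multV compV"
    and bU: "graded_algebra.graded_basis scaleU compU J u"
    and bV: "graded_algebra.graded_basis scaleV compV J v"
    and eq: "graded_algebra.struct_const scaleU multU J u = graded_algebra.struct_const scaleV multV J v"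
  shows "graded_isomorphic scaleU multU compU scaleV multV compV"
proof -
  interpret U: closed_graded_simple_algebra scaleU multU compU by (rule U)
  interpret V: closed_graded_simple_algebra scaleV multV compV by (rule V)
  interpret UV: vector_space_pair scaleU scaleV ..
  define \<psi> where "\<psi> w = (\<Sum>j\<in>J. scaleV (U.crd J u w j) (v j))" for w
  define \<chi> where "\<chi> w = (\<Sum>j\<in>J. scaleU (V.crd J v w j) (u j))" for w
  have \<psi>: "Vector_Spaces.linear scaleU scaleV \<psi>"
    by unfold_locales (simp_all add: \<psi>_def U.crd_add[OF bU] U.crd_scale[OF bU] V.scale_left_distrib
      sum.distrib V.scale_sum_right)
  then interpret \<psi>: Vector_Spaces.linear scaleU scaleV \<psi> .
  have \<psi>u: "\<psi> (u i) = v i" if "i \<in> J" for i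
  proof -
    have "\<psi> (u i) = (\<Sum>j\<in>J. if j = i then v i else 0)"
      unfolding \<psi>_def using that by (intro sum.cong) (auto simp: U.crd_basis[OF bU])
    then show ?thesis using that U.graded_basisD(1)[OF bU] by simp
  qed
  have "\<chi> (\<psi> w) = w" for w
  proof -
    have "V.crd J v (\<psi> w) j = U.crd J u w j" if "j \<in> J" for j
      by (rule V.crd_eqI[OF bV _ that]) (simp add: \<psi>_def)
    then show ?thesis unfolding \<chi>_def using U.crd_sum[OF bU, of w, symmetric] by simp
  qed
  moreover have \<psi>\<chi>: "\<psi> (\<chi> w) = w" for w
  proof -
    have "U.crd J u (\<chi> w) j = V.crd J v w j" if "j \<in> J" for j
      by (rule U.crd_eqI[OF bU _ that]) (simp add: \<chi>_def)
    then show ?thesis unfolding \<psi>_def using V.crd_sum[OF bV, of w, symmetric] by simp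
  qed
  ultimately have "bij \<psi>" by (intro o_bij[of \<chi>]) (auto simp: fun_eq_iff)
  moreover have "\<psi> (multU x y) = multV (\<psi> x) (\<psi> y)" for x y
  proof -
    have basis: "\<psi> (multU (u i) (u j)) = multV (v i) (v j)" if "i \<in> J" "j \<in> J" for i j
    proof -
      have "\<psi> (multU (u i) (u j)) = (\<Sum>k\<in>J. scaleV (V.crd J v (multV (v i) (v j)) k) (v k))"
        unfolding \<psi>_def using that
        by (intro sum.cong refl) (simp add: U.crd_mult_basis[OF bU] V.crd_mult_basis[OF bV] eq)
      then show ?thesis using V.crd_sum[OF bV, of "multV (v i) (v j)", symmetric] by simp
    qed
    have "\<psi> (multU x y) = \<psi> (multU (\<Sum>i\<in>J. scaleU (U.crd J u x i) (u i)) (\<Sum>j\<in>J. scaleU (U.crd J u y j) (u j)))"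
      using U.crd_sum[OF bU, of x, symmetric] U.crd_sum[OF bU, of y, symmetric] by simp
    also have "\<dots> = (\<Sum>j\<in>J. scaleV (U.crd J u y j) (\<Sum>i\<in>J. scaleV (U.crd J u x i) (multV (v i) (v j))))"
      unfolding U.mr.sum U.mr.scale U.ml.sum U.ml.scale \<psi>.sum \<psi>.scale
      by (intro sum.cong refl arg_cong2[of _ _ _ _ scaleV]) (simp_all add: basis)
    also have "\<dots> = multV (\<psi> x) (\<psi> y)"
      unfolding \<psi>_def V.mr.sum V.mr.scale V.ml.sum V.ml.scale ..
    finally show ?thesis .
  qed
  moreover have "\<psi> ` compU g = compV g" for g
  proof
    show "\<psi> ` compU g \<subseteq> compV g"
    proof
      fix y assume "y \<in> \<psi> ` compU g"
      then obtain x where x: "x \<in> compU g" "y = \<psi> x" by blast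
      have "\<psi> x = (\<Sum>j | j \<in> J \<and> fst j = g. scaleV (U.crd J u x j) (\<psi> (u j)))"
        by (subst U.crd_sum_homogeneous[OF bU x(1)]) (simp only: \<psi>.sum \<psi>.scale)
      also have "\<dots> \<in> compV g"
        using V.graded_basisD(3)[OF bV]
        by (intro V.subspace_sum[OF V.subspace_comp] V.subspace_scale[OF V.subspace_comp]) (auto simp: \<psi>u)
      finally show "y \<in> compV g" using x by simp
    qed
    show "compV g \<subseteq> \<psi> ` compU g"
    proof
      fix y assume y: "y \<in> compV g"
      have "(\<Sum>j | j \<in> J \<and> fst j = g. scaleU (V.crd J v y j) (u j)) \<in> compU g"
        using U.graded_basisD(3)[OF bU]
        by (intro U.subspace_sum[OF U.subspace_comp] U.subspace_scale[OF U.subspace_comp]) auto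
      moreover have "\<psi> (\<Sum>j | j \<in> J \<and> fst j = g. scaleU (V.crd J v y j) (u j))
          = (\<Sum>j | j \<in> J \<and> fst j = g. scaleV (V.crd J v y j) (v j))"
        unfolding \<psi>.sum \<psi>.scale by (intro sum.cong refl arg_cong2[of _ _ _ _ scaleV]) (simp_all add: \<psi>u)
      ultimately show "y \<in> \<psi> ` compU g"
        using V.crd_sum_homogeneous[OF bV y, symmetric] by (metis (no_types, lifting) image_eqI)
    qed
  qed
  ultimately show ?thesis unfolding graded_isomorphic_def using \<psi> by blast
qed

lemma isomorphism_preserves_identity:
  fixes compU :: "'g::ab_group_add \<Rightarrow> 'u::ab_group_add set"
  assumes "graded_algebra scaleU multU compU" and "graded_algebra scaleV multV compV"
    and iso: "graded_isomorphic scaleU multU compU scaleV multV compV"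
  shows "graded_algebra.graded_identity scaleU multU compU f \<longleftrightarrow> graded_algebra.graded_identity scaleV multV compV f"
proof -
  interpret U: graded_algebra scaleU multU compU by fact
  interpret V: graded_algebra scaleV multV compV by fact
  obtain \<psi> where \<psi>: "Vector_Spaces.linear scaleU scaleV \<psi>" and bij: "bij \<psi>"
    and mul: "\<And>x y. \<psi> (multU x y) = multV (\<psi> x) (\<psi> y)" and comp: "\<And>g. \<psi> ` compU g = compV g"
    using iso unfolding graded_isomorphic_def by blast
  interpret \<psi>: Vector_Spaces.linear scaleU scaleV \<psi> by (rule \<psi>)
  have "\<psi> (eval_magma multU u t) = eval_magma multV (\<lambda>x. \<psi> (u x)) t" for u :: "'g \<times> nat \<Rightarrow> 'u" and t
    by (induction t) (simp_all add: mul)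
  then have ev: "V.eval_poly (\<lambda>x. \<psi> (u x)) f = \<psi> (U.eval_poly u f)" for u
    by (simp add: U.eval_poly_def V.eval_poly_def \<psi>.sum \<psi>.scale)
  have inj: "\<psi> x = 0 \<longleftrightarrow> x = 0" for x
    using bij \<psi>.zero by (metis bij_is_inj injD)
  show ?thesis unfolding U.graded_identity_iff V.graded_identity_iff
  proof (intro iffI allI impI)
    fix v assume id: "\<forall>u. U.graded_assignment u \<longrightarrow> U.eval_poly u f = 0" and v: "V.graded_assignment v"
    define u where "u x = inv \<psi> (v x)" for x
    have \<psi>u: "\<psi> (u x) = v x" for x unfolding u_def by (rule surj_f_inv_f[OF bij_is_surj[OF bij]])
    have "U.graded_assignment u" unfolding U.graded_assignment_def
    proof
      fix x
      have "v x \<in> \<psi> ` compU (fst x)" using v unfolding comp V.graded_assignment_def by blast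
      then show "u x \<in> compU (fst x)" unfolding u_def using bij by (auto simp: bij_is_inj)
    qed
    then show "V.eval_poly v f = 0" using id ev[of u] by (simp add: \<psi>u \<psi>.zero)
  next
    fix u assume id: "\<forall>v. V.graded_assignment v \<longrightarrow> V.eval_poly v f = 0" and u: "U.graded_assignment u"
    have "V.graded_assignment (\<lambda>x. \<psi> (u x))"
      using u comp unfolding U.graded_assignment_def V.graded_assignment_def by blast
    then show "U.eval_poly u f = 0" using id ev[of u] inj by auto
  qed
qed

theorem theorem1:
  fixes scaleU :: "'f::alg_closed_field \<Rightarrow> 'u::ab_group_add \<Rightarrow> 'u"
    and multU :: "'u \<Rightarrow> 'u \<Rightarrow> 'u"
    and compU :: "'g::ab_group_add \<Rightarrow> 'u set"
    and scaleV :: "'f \<Rightarrow> 'v::ab_group_add \<Rightarrow> 'v"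
    and multV :: "'v \<Rightarrow> 'v \<Rightarrow> 'v"
    and compV :: "'g \<Rightarrow> 'v set"
  assumes "fin_dim_graded_simple_algebra scaleU multU compU"
    and "fin_dim_graded_simple_algebra scaleV multV compV"
  shows "(\<forall>f :: ('g, 'f) graded_poly.
            graded_algebra.graded_identity scaleU multU compU f \<longleftrightarrow>
            graded_algebra.graded_identity scaleV multV compV f) \<longleftrightarrow>
         graded_isomorphic scaleU multU compU scaleV multV compV"
proof
  have cU: "closed_graded_simple_algebra scaleU multU compU"
    and cV: "closed_graded_simple_algebra scaleV multV compV"
    using assms by (auto intro: closed_graded_simple_algebra.intro)
  interpret U: closed_graded_simple_algebra scaleU multU compU by (rule cU)
  interpret V: closed_graded_simple_algebra scaleV multV compV by (rule cV)
  {
    assume "graded_isomorphic scaleU multU compU scaleV multV compV"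
    then show "\<forall>f. U.graded_identity f \<longleftrightarrow> V.graded_identity f"
      using isomorphism_preserves_identity[OF U.graded_algebra_axioms V.graded_algebra_axioms] by blast
  next
    assume same: "\<forall>f. U.graded_identity f \<longleftrightarrow> V.graded_identity f"
    then have UV: "\<And>f. U.graded_identity f \<Longrightarrow> V.graded_identity f"
      and VU: "\<And>f. V.graded_identity f \<Longrightarrow> U.graded_identity f" by blast+
    obtain J u0 where u0: "U.graded_basis J u0" using U.exists_graded_basis by blast
    obtain J' v' where v': "V.graded_basis J' v'" using V.exists_graded_basis by blast
    have "card J = V.dim UNIV"
      using dim_le_of_identities[OF cU cV u0 VU] dim_le_of_identities[OF cV cU v' UV]
        U.graded_basis_card[OF u0] V.graded_basis_card[OF v'] by simp
    then obtain v0 where v0: "V.graded_basis J v0" using dim_le_of_identities[OF cU cV u0 VU] by blast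
    obtain Q v where v: "V.graded_basis J v" "pexp_eval (V.struct_const J v) Q \<noteq> 0"
      and Q: "\<And>c. pexp_eval c Q \<noteq> 0 \<Longrightarrow>
        (\<And>P. (\<And>v. V.graded_basis J v \<Longrightarrow> pexp_eval (V.struct_const J v) P = 0) \<Longrightarrow> pexp_eval c P = 0) \<Longrightarrow>
        \<exists>v. V.graded_basis J v \<and> V.struct_const J v = c"
      using V.structure_constants_of_generic_point[OF v0] by blast
    obtain u where u: "U.graded_basis J u" "pexp_eval (U.struct_const J u) Q \<noteq> 0"
      using structure_polynomial_transfer[OF cU cV u0 UV _ v(1)] v(2) by blast
    obtain w where "V.graded_basis J w" "V.struct_const J w = U.struct_const J u"
      using Q[OF u(2)] structure_polynomial_transfer[OF cV cU v0 VU _ u(1)] by blast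
    then show "graded_isomorphic scaleU multU compU scaleV multV compV"
      using graded_isomorphic_of_struct_const[OF cU cV u(1)] by metis
  }
qed

end
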